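(* Let $P_0$ be an open subset of $P_*=\{(\mathbf{w},\mathbf{p},\mathbf{q})\in P:\ \mathbf{w}_j\neq0\text{ for all }j\}$, let $H\colon P_0\to\mathbb{R}$ be smooth, $N_0=\psi^{-1}(P_0)$, and let $X_{H\circ\psi}$ be the Hamiltonian vector field of $H\circ\psi$ on $N_0$. Assume that this system on $N_0$ is integrated with a partitioned Runge--Kutta method with update map $\Phi_h\colon U\to N$, where - $\mathbf{z}$ is integrated with a symplectic Runge--Kutta method, - $(\mathbf{p},\mathbf{q})$ is integrated with a symplectic partitioned Runge--Kutta method, and - the $b$-coefficients of the two methods above coincide. Then $\Phi_h$ is symplectic, $\Phi_h^*\omega_N=\omega_N$. Furthermore, it descends to a symplectic method on $P$: there is a map $\varphi_h\colon\psi(U)\to P$ with $\varphi_h\circ\psi=\psi\circ\Phi_h$ on $U$, and $\varphi_h$ is a Poisson map that maps $L\cap\psi(U)$ into $L$ for every symplectic leaf $L$ of $P$. Finally, $\varphi_h$ restricts to a symplectic method on $M$: it maps $M\cap\psi(U)$ into $M$ and $(\varphi_h|_{M\cap\psi(U)})^*\omega=\omega$.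
   Context: $M=(S^2)^n\times T^*\mathbb{R}^m\subset P=(\mathbb{R}^3)^n\times T^*\mathbb{R}^m$, $S^2$ the unit sphere; points of $P$ are $(\mathbf{w},\mathbf{p},\mathbf{q})$, $\mathbf{w}=(\mathbf{w}_1,\dots,\mathbf{w}_n)$. $M$ has symplectic form $\omega=\sum_i dq_i\wedge dp_i+\sum_j dA_j$, with $dA_j$ the standard area form on the $j$-th sphere, $(dA_j)_{\mathbf{w}_j}(u,v)=\langle\mathbf{w}_j,u\times v\rangle$. $P$ has Poisson bracket $$\{f,g\}=\sum_{i=1}^m\left(\frac{\partial f}{\partial q_i}\frac{\partial g}{\partial p_i}-\frac{\partial f}{\partial p_i}\frac{\partial g}{\partial q_i}\right)+\sum_{j=1}^n\left\langle \mathbf{w}_j,\frac{\partial f}{\partial \mathbf{w}_j}\times\frac{\partial g}{\partial \mathbf{w}_j}\right\rangle,$$ with symplectic leaves $\{\|\mathbf{w}_j\|=r_j,\ j=1,\dots,n\}$, $r_j\ge0$; $M$ is the leaf with all $r_j=1$. (A Hamiltonian $H_M$ on $M$ is extended to $P_*$ in the paper by $H_M\circ\rho$, $\rho(\mathbf{w},\mathbf{p},\mathbf{q})=(\mathbf{w}_1/\|\mathbf{w}_1\|,\dots,\mathbf{w}_n/\|\mathbf{w}_n\|,\mathbf{p},\mathbf{q})$.) $N=\mathbb{C}^{2n}\times T^*\mathbb{R}^m$ with points $(\mathbf{z},\mathbf{p},\mathbf{q})$, $\mathbf{z}=(\mathbf{z}_1,\mathbf{z}_2)$, $\mathbf{z}_i=(z_i^1,\dots,z_i^n)\in\mathbb{C}^n$,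 has the canonical symplectic form $\omega_N=\sum_{i,j}d\,\mathrm{Im}\,z_i^j\wedge d\,\mathrm{Re}\,z_i^j+\sum_k dq_k\wedge dp_k$. The map $\psi\colon N\to P$ is $\psi(\mathbf{z}_1,\mathbf{z}_2,\mathbf{p},\mathbf{q})=(J(z_1^1,z_2^1),\dots,J(z_1^n,z_2^n),\mathbf{p},\mathbf{q})$ with $$J(z_1,z_2)=\tfrac14\left(2\,\mathrm{Re}(z_1z_2^* ),\ 2\,\mathrm{Im}(z_1z_2^* ),\ |z_1|^2-|z_2|^2\right).$$ The Hamiltonian vector field $X_G$ of a function $G$ satisfies $dF(X_G)=\{F,G\}$, where on $N$ the bracket has $\{q_k,p_k\}=1$ and $\{\mathrm{Im}\,z_i^j,\mathrm{Re}\,z_i^j\}=1$. Partitioned Runge--Kutta method: writing the vector field as $(f^{z},f^{p},f^{q})$, each of the components $c\in\{z,p,q\}$ has its own real coefficients $a^c_{ij},b^c_i$ ($1\le i,j\le s$); for initial value $x=(x^z,x^p,x^q)$ and step size $h$ the stage equations are $X_i^c=x^c+h\sum_{j=1}^s a^c_{ij}f^c(X_j)$ with $X_i=(X_i^z,X_i^p,X_i^q)\in N_0$, and the update is $\Phi_h(x)^c=x^c+h\sum_{i=1}^s b_i^c f^c(X_i)$. All real components of $\mathbf{z}$ use the same coefficients $a^z,b^z$. As usual, $\Phi_h$ is considered on an open set $U\subseteq N_0$ on which the stage equations have a unique solution $(X_1,\dots,X_s)\in N_0^s$, depending smoothly on $x$. The $\mathbf{z}$-method is symplectic if $b^z_ib^z_j=b^z_ia^z_{ij}+b^z_ja^z_{ji}$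 for all $i,j$. The $(\mathbf{p},\mathbf{q})$-method is a symplectic partitioned Runge--Kutta method if $b^p_ib^q_j=b^p_ia^q_{ij}+b^q_ja^p_{ji}$ and $b^p_i=b^q_i$ for all $i,j$. The $b$-coefficients coincide if $b^z_i=b^p_i=b^q_i$ for all $i$. *)

theory Defs
  imports "HOL-Analysis.Analysis"
begin

section \<open>Smooth maps\<close>

text \<open>On open subsets of finite-dimensional spaces, which is the only use made of it here, this is
  the usual notion of a \<open>C\<^sup>k\<close> map: all iterated directional derivatives of order up to \<open>k\<close> exist
  and are continuous.\<close>

primrec Ck_on :: "nat \<Rightarrow> 'a set \<Rightarrow> ('a::real_normed_vector \<Rightarrow> 'b::real_normed_vector) \<Rightarrow> bool" where
  "Ck_on 0 S f \<longleftrightarrow> continuous_on S f"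
| "Ck_on (Suc k) S f \<longleftrightarrow>
     (\<forall>x\<in>S. f differentiable (at x)) \<and> (\<forall>v. Ck_on k S (\<lambda>x. frechet_derivative f (at x) v))"

definition smooth_on :: "'a set \<Rightarrow> ('a::real_normed_vector \<Rightarrow> 'b::real_normed_vector) \<Rightarrow> bool" where
  "smooth_on S f \<longleftrightarrow> (\<forall>k. Ck_on k S f)"

section \<open>The spaces\<close>

text \<open>\<open>\<real>\<^sup>m\<close> is represented by a type \<open>'e\<close> of class \<^class>\<open>real_inner\<close> with a finite orthonormal basis
  \<open>B\<close>, where \<open>m = card B\<close>, and \<open>q\<^sub>b = q \<bullet> b\<close> for \<open>b \<in> B\<close> are the coordinates of \<open>q\<close>. For \<open>m \<ge> 1\<close>
  this is \<open>real ^ 'm\<close> with \<open>B = Basis\<close>. The class \<^class>\<open>euclidean_space\<close> (in particular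
  \<open>real ^ 'm\<close>) would exclude \<open>m = 0\<close>, the case of pure spin systems; this is the type \<open>unit\<close>
  with \<open>B = {}\<close>, see below.\<close>

definition orthonormal_basis :: "'e::real_inner set \<Rightarrow> bool" where
  "orthonormal_basis B \<longleftrightarrow>
     finite B \<and> pairwise orthogonal B \<and> (\<forall>b\<in>B. norm b = 1) \<and> span B = UNIV"

instantiation unit :: real_inner
begin
definition plus_unit :: "unit \<Rightarrow> unit \<Rightarrow> unit" where "plus_unit x y = ()"
definition minus_unit :: "unit \<Rightarrow> unit \<Rightarrow> unit" where "minus_unit x y = ()"
definition uminus_unit :: "unit \<Rightarrow> unit" where "uminus_unit x = ()"
definition zero_unit :: unit where "zero_unit = ()"
definition scaleR_unit :: "real \<Rightarrow> unit \<Rightarrow> unit" where "scaleR_unit r x = ()"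
definition norm_unit :: "unit \<Rightarrow> real" where "norm_unit x = 0"
definition dist_unit :: "unit \<Rightarrow> unit \<Rightarrow> real" where "dist_unit x y = 0"
definition sgn_unit :: "unit \<Rightarrow> unit" where "sgn_unit x = ()"
definition inner_unit :: "unit \<Rightarrow> unit \<Rightarrow> real" where "inner_unit x y = 0"
definition uniformity_unit :: "(unit \<times> unit) filter" where
  "uniformity_unit = (INF e\<in>{0<..}. principal {(x, y). dist x y < e})"
definition open_unit :: "unit set \<Rightarrow> bool" where
  "open_unit S \<longleftrightarrow> (\<forall>x\<in>S. \<forall>\<^sub>F (x', y) in uniformity. x' = x \<longrightarrow> y \<in> S)"
instance
  by standard (simp_all add: norm_unit_def dist_unit_def inner_unit_def
      uniformity_unit_def open_unit_def)
end

lemma orthonormal_basis_Basis: "orthonormal_basis (Basis :: 'a::euclidean_space set)"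
  by (simp add: orthonormal_basis_def pairwise_def orthogonal_def inner_Basis)

lemma orthonormal_basis_unit: "orthonormal_basis ({} :: unit set)"
  by (auto simp: orthonormal_basis_def)

text \<open>Points of \<open>P\<close> are \<open>(w, p, q)\<close>, points of \<open>N\<close> are \<open>((z\<^sub>1, z\<^sub>2), p, q)\<close>.\<close>

type_synonym ('n, 'e) P = "(real ^ 3 ^ 'n) \<times> 'e \<times> 'e"
type_synonym ('n, 'e) N = "((complex ^ 'n) \<times> (complex ^ 'n)) \<times> 'e \<times> 'e"

definition P_star :: "('n::finite, 'e::real_inner) P set" where
  "P_star = {(w, p, q). \<forall>j. w $ j \<noteq> 0}"

definition J :: "complex \<Rightarrow> complex \<Rightarrow> real ^ 3" where
  "J z1 z2 = (1 / 4) *\<^sub>R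
     vector [2 * Re (z1 * cnj z2), 2 * Im (z1 * cnj z2), (cmod z1)\<^sup>2 - (cmod z2)\<^sup>2]"

definition psi :: "('n::finite, 'e::real_inner) N \<Rightarrow> ('n, 'e) P" where
  "psi = (\<lambda>((z1, z2), p, q). ((\<chi> j. J (z1 $ j) (z2 $ j)), p, q))"

section \<open>The symplectic manifold \<open>N\<close>\<close>

definition omega_N ::
  "'e::real_inner set \<Rightarrow> ('n::finite, 'e) N \<Rightarrow> ('n, 'e) N \<Rightarrow> real" where
  "omega_N B = (\<lambda>((u1, u2), up, uq) ((v1, v2), vp, vq).
     (\<Sum>j\<in>UNIV. Im (u1 $ j) * Re (v1 $ j) - Re (u1 $ j) * Im (v1 $ j)) +
     (\<Sum>j\<in>UNIV. Im (u2 $ j) * Re (v2 $ j) - Re (u2 $ j) * Im (v2 $ j)) +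
     (\<Sum>b\<in>B. (uq \<bullet> b) * (vp \<bullet> b) - (up \<bullet> b) * (vq \<bullet> b)))"

definition bracket_N ::
  "'e::real_inner set \<Rightarrow> (('n::finite, 'e) N \<Rightarrow> real) \<Rightarrow> (('n, 'e) N \<Rightarrow> real) \<Rightarrow>
     ('n, 'e) N \<Rightarrow> real" where
  "bracket_N B F G x =
     (let dF = frechet_derivative F (at x); dG = frechet_derivative G (at x);
          re1 = (\<lambda>j. ((axis j 1, 0), 0, 0)); im1 = (\<lambda>j. ((axis j \<i>, 0), 0, 0));
          re2 = (\<lambda>j. ((0, axis j 1), 0, 0)); im2 = (\<lambda>j. ((0, axis j \<i>), 0, 0));
          p = (\<lambda>b. (0, b, 0)); q = (\<lambda>b. (0, 0, b))
      in (\<Sum>j\<in>UNIV. dF (im1 j) * dG (re1 j) - dF (re1 j) * dG (im1 j)) +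
         (\<Sum>j\<in>UNIV. dF (im2 j) * dG (re2 j) - dF (re2 j) * dG (im2 j)) +
         (\<Sum>b\<in>B. dF (q b) * dG (p b) - dF (p b) * dG (q b)))"

definition hamiltonian_vector_field_on ::
  "'e::real_inner set \<Rightarrow> ('n::finite, 'e) N set \<Rightarrow> (('n, 'e) N \<Rightarrow> real) \<Rightarrow>
     (('n, 'e) N \<Rightarrow> ('n, 'e) N) \<Rightarrow> bool" where
  "hamiltonian_vector_field_on B S G X \<longleftrightarrow>
     (\<forall>F. smooth_on S F \<longrightarrow>
        (\<forall>x\<in>S. frechet_derivative F (at x) (X x) = bracket_N B F G x))"

definition symplectic_map_on_N ::
  "'e::real_inner set \<Rightarrow> ('n::finite, 'e) N set \<Rightarrow> (('n, 'e) N \<Rightarrow> ('n, 'e) N) \<Rightarrow> bool" where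
  "symplectic_map_on_N B U \<Phi> \<longleftrightarrow>
     open U \<and> smooth_on U \<Phi> \<and>
     (\<forall>x\<in>U. \<forall>u v. omega_N B (frechet_derivative \<Phi> (at x) u) (frechet_derivative \<Phi> (at x) v)
                   = omega_N B u v)"

section \<open>The Poisson manifold \<open>P\<close>\<close>

definition grad_w :: "(('n::finite, 'e::real_inner) P \<Rightarrow> real) \<Rightarrow> 'n \<Rightarrow> ('n, 'e) P \<Rightarrow> real ^ 3" where
  "grad_w f j x = (\<chi> i. frechet_derivative f (at x) (axis j (axis i 1), 0, 0))"

definition bracket_P ::
  "'e::real_inner set \<Rightarrow> (('n::finite, 'e) P \<Rightarrow> real) \<Rightarrow> (('n, 'e) P \<Rightarrow> real) \<Rightarrow>
     ('n, 'e) P \<Rightarrow> real" where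
  "bracket_P B f g x =
     (let df = frechet_derivative f (at x); dg = frechet_derivative g (at x);
          p = (\<lambda>b. (0, b, 0)); q = (\<lambda>b. (0, 0, b))
      in (\<Sum>b\<in>B. df (q b) * dg (p b) - df (p b) * dg (q b)) +
         (\<Sum>j\<in>UNIV. (fst x $ j) \<bullet> cross3 (grad_w f j x) (grad_w g j x)))"

definition poisson_map_on ::
  "'e::real_inner set \<Rightarrow> ('n::finite, 'e) P set \<Rightarrow> (('n, 'e) P \<Rightarrow> ('n, 'e) P) \<Rightarrow> bool" where
  "poisson_map_on B S \<phi> \<longleftrightarrow>
     open S \<and> smooth_on S \<phi> \<and>
     (\<forall>V f g. open V \<longrightarrow> smooth_on V f \<longrightarrow> smooth_on V g \<longrightarrow>
        (\<forall>x\<in>S. \<phi> x \<in> V \<longrightarrow> bracket_P B (f \<circ> \<phi>) (g \<circ> \<phi>) x = bracket_P B f g (\<phi> x)))"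

definition symplectic_leaves :: "('n::finite, 'e::real_inner) P set set" where
  "symplectic_leaves =
     {{(w, p, q). \<forall>j. norm (w $ j) = r j} | r :: 'n \<Rightarrow> real. \<forall>j. r j \<ge> 0}"

section \<open>The symplectic manifold \<open>M\<close>\<close>

definition M :: "('n::finite, 'e::real_inner) P set" where
  "M = {(w, p, q). \<forall>j. norm (w $ j) = 1}"

definition tangent_M :: "('n::finite, 'e::real_inner) P \<Rightarrow> ('n, 'e) P set" where
  "tangent_M = (\<lambda>(w, p, q). {(u, up, uq). \<forall>j. (w $ j) \<bullet> (u $ j) = 0})"

definition omega_M ::
  "'e::real_inner set \<Rightarrow> ('n::finite, 'e) P \<Rightarrow> ('n, 'e) P \<Rightarrow> ('n, 'e) P \<Rightarrow> real" where
  "omega_M B = (\<lambda>(w, p, q) (u, up, uq) (v, vp, vq).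
     (\<Sum>b\<in>B. (uq \<bullet> b) * (vp \<bullet> b) - (up \<bullet> b) * (vq \<bullet> b)) +
     (\<Sum>j\<in>UNIV. (w $ j) \<bullet> cross3 (u $ j) (v $ j)))"

text \<open>Used for a map \<open>\<phi>\<close> that is smooth on the open set \<open>S\<close> of \<open>P\<close>: the derivative of
  the restriction of \<open>\<phi>\<close> to the submanifold \<open>M \<inter> S\<close> at \<open>x\<close> is then the restriction of the
  derivative of \<open>\<phi>\<close> to the tangent space of \<open>M\<close> at \<open>x\<close>.\<close>

definition restricts_to_symplectic_map_on_M ::
  "'e::real_inner set \<Rightarrow> ('n::finite, 'e) P set \<Rightarrow> (('n, 'e) P \<Rightarrow> ('n, 'e) P) \<Rightarrow> bool" where
  "restricts_to_symplectic_map_on_M B S \<phi> \<longleftrightarrow>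
     \<phi> ` (M \<inter> S) \<subseteq> M \<and>
     (\<forall>x\<in>M \<inter> S. \<forall>u\<in>tangent_M x. \<forall>v\<in>tangent_M x.
        frechet_derivative \<phi> (at x) u \<in> tangent_M (\<phi> x) \<and>
        omega_M B (\<phi> x) (frechet_derivative \<phi> (at x) u) (frechet_derivative \<phi> (at x) v)
          = omega_M B x u v)"

section \<open>Partitioned Runge--Kutta methods\<close>

definition symplectic_rk :: "nat \<Rightarrow> (nat \<Rightarrow> nat \<Rightarrow> real) \<Rightarrow> (nat \<Rightarrow> real) \<Rightarrow> bool" where
  "symplectic_rk s a b \<longleftrightarrow>
     (\<forall>i\<in>{1..s}. \<forall>j\<in>{1..s}. b i * b j = b i * a i j + b j * a j i)"

definition symplectic_prk ::
  "nat \<Rightarrow> (nat \<Rightarrow> nat \<Rightarrow> real) \<Rightarrow> (nat \<Rightarrow> real) \<Rightarrow>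
     (nat \<Rightarrow> nat \<Rightarrow> real) \<Rightarrow> (nat \<Rightarrow> real) \<Rightarrow> bool" where
  "symplectic_prk s ap bp aq bq \<longleftrightarrow>
     (\<forall>i\<in>{1..s}. \<forall>j\<in>{1..s}. bp i * bq j = bp i * aq i j + bq j * ap j i) \<and>
     (\<forall>i\<in>{1..s}. bp i = bq i)"

text \<open>The first component \<open>'z\<close> of the phase space is integrated with \<open>az\<close>, \<open>bz\<close>, and the second
  and third component with \<open>ap\<close>, \<open>bp\<close> and \<open>aq\<close>, \<open>bq\<close>, respectively.\<close>

definition prk_stages ::
  "nat \<Rightarrow> (nat \<Rightarrow> nat \<Rightarrow> real) \<Rightarrow> (nat \<Rightarrow> nat \<Rightarrow> real) \<Rightarrow> (nat \<Rightarrow> nat \<Rightarrow> real) \<Rightarrow>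
     real \<Rightarrow> ('z::real_vector \<times> 'p::real_vector \<times> 'q::real_vector \<Rightarrow> 'z \<times> 'p \<times> 'q) \<Rightarrow>
     ('z \<times> 'p \<times> 'q) set \<Rightarrow> 'z \<times> 'p \<times> 'q \<Rightarrow> (nat \<Rightarrow> 'z \<times> 'p \<times> 'q) \<Rightarrow> bool" where
  "prk_stages s az ap aq h f D x Y \<longleftrightarrow>
     (\<forall>i\<in>{1..s}. Y i \<in> D \<and>
        Y i = (fst x + h *\<^sub>R (\<Sum>j=1..s. az i j *\<^sub>R fst (f (Y j))),
               fst (snd x) + h *\<^sub>R (\<Sum>j=1..s. ap i j *\<^sub>R fst (snd (f (Y j)))),
               snd (snd x) + h *\<^sub>R (\<Sum>j=1..s. aq i j *\<^sub>R snd (snd (f (Y j))))))"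

definition prk_update ::
  "nat \<Rightarrow> (nat \<Rightarrow> real) \<Rightarrow> (nat \<Rightarrow> real) \<Rightarrow> (nat \<Rightarrow> real) \<Rightarrow>
     real \<Rightarrow> ('z::real_vector \<times> 'p::real_vector \<times> 'q::real_vector \<Rightarrow> 'z \<times> 'p \<times> 'q) \<Rightarrow>
     'z \<times> 'p \<times> 'q \<Rightarrow> (nat \<Rightarrow> 'z \<times> 'p \<times> 'q) \<Rightarrow> 'z \<times> 'p \<times> 'q" where
  "prk_update s bz bp bq h f x Y =
     (fst x + h *\<^sub>R (\<Sum>i=1..s. bz i *\<^sub>R fst (f (Y i))),
      fst (snd x) + h *\<^sub>R (\<Sum>i=1..s. bp i *\<^sub>R fst (snd (f (Y i)))),
      snd (snd x) + h *\<^sub>R (\<Sum>i=1..s. bq i *\<^sub>R snd (snd (f (Y i)))))"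

text \<open>\<open>\<Phi>\<close> is the update map of the method on the open set \<open>U \<subseteq> D\<close>, on which the stage equations
  are uniquely solvable in \<open>D\<close> and the stages \<open>Y x 1, \<dots>, Y x s\<close> depend smoothly on \<open>x\<close>.\<close>

definition prk_update_map_on ::
  "nat \<Rightarrow> (nat \<Rightarrow> nat \<Rightarrow> real) \<Rightarrow> (nat \<Rightarrow> real) \<Rightarrow> (nat \<Rightarrow> nat \<Rightarrow> real) \<Rightarrow> (nat \<Rightarrow> real) \<Rightarrow>
     (nat \<Rightarrow> nat \<Rightarrow> real) \<Rightarrow> (nat \<Rightarrow> real) \<Rightarrow> real \<Rightarrow>
     ('z::real_normed_vector \<times> 'p::real_normed_vector \<times> 'q::real_normed_vector
        \<Rightarrow> 'z \<times> 'p \<times> 'q) \<Rightarrow>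
     ('z \<times> 'p \<times> 'q) set \<Rightarrow> ('z \<times> 'p \<times> 'q) set \<Rightarrow> ('z \<times> 'p \<times> 'q \<Rightarrow> 'z \<times> 'p \<times> 'q) \<Rightarrow> bool" where
  "prk_update_map_on s az bz ap bp aq bq h f D U \<Phi> \<longleftrightarrow>
     open U \<and> U \<subseteq> D \<and>
     (\<exists>Y. (\<forall>x\<in>U. prk_stages s az ap aq h f D x (Y x)) \<and>
          (\<forall>x\<in>U. \<forall>Y'. prk_stages s az ap aq h f D x Y' \<longrightarrow> (\<forall>i\<in>{1..s}. Y' i = Y x i)) \<and>
          (\<forall>i\<in>{1..s}. smooth_on U (\<lambda>x. Y x i)) \<and>
          (\<forall>x\<in>U. \<Phi> x = prk_update s bz bp bq h f x (Y x)))"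

end

theory Submission
  imports Defs
begin

text \<open>
  On each factor \<open>\<complex>\<^sup>2\<close> the map \<open>psi\<close> is the Hopf map: its fibres are the orbits of a torus that
  multiplies each pair \<open>(z\<^sub>1\<^sup>j, z\<^sub>2\<^sup>j)\<close> by a phase, it is a Poisson map onto \<open>P\<close>, and the length of
  \<open>w\<^sub>j\<close> is, up to a factor, the momentum map \<open>|z\<^sub>1\<^sup>j|\<^sup>2 + |z\<^sub>2\<^sup>j|\<^sup>2\<close> of the \<open>j\<close>-th circle. The theorem says
  that a symplectic method upstairs respects this picture, and there are three reasons.

  First, \<open>\<Phi>\<close> is symplectic. By \<open>rk_bilinear_increment\<close> a bilinear pairing of two components changes
  under a step by the weighted sum over the stages of its infinitesimal changes, provided that the
  coefficients satisfy the symplecticity relation. Applied to the variational equation with the three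
  pairings that make up \<open>omega_N\<close>, the common weights add the infinitesimal changes up to that of
  \<open>omega_N\<close>, which is zero because the Hessian of the Hamiltonian is symmetric
  (\<open>hamiltonian_linearization_skew\<close>, \<open>prk_update_symplectic\<close>). The same lemma, applied to the quadratic
  first integral \<open>|z\<^sub>1\<^sup>j|\<^sup>2 + |z\<^sub>2\<^sup>j|\<^sup>2\<close> of the collective Hamiltonian, shows that the lengths of the
  \<open>w\<^sub>j\<close> are conserved (\<open>norm_psi_Phi\<close>).

  Second, \<open>\<Phi>\<close> descends. The vector field of \<open>H \<circ> psi\<close> is equivariant under the torus, which acts
  linearly on the \<open>z\<close> component; since the stages are unique, points of one fibre have stages that differ
  by a rotation, and are mapped into one fibre (\<open>psi_Phi_cong\<close>). The induced map \<open>\<phi>\<close> is smooth because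
  \<open>psi\<close> has smooth local sections through every point over \<open>P_star\<close> (\<open>psi_local_section\<close>), for which
  explicit formulas are given.

  Third, the geometry of \<open>\<phi>\<close> is inherited. Both \<open>psi\<close> and the symplectic map \<open>\<Phi>\<close> are Poisson maps, so
  \<open>\<phi>\<close> is one. Conservation of the lengths gives the statement on leaves. Finally, the form on \<open>M\<close>
  is obtained by symplectic reduction: over \<open>M\<close> it pulls back to \<open>omega_N\<close> on vectors tangent to the level
  set of the momentum map (\<open>psi_reduction\<close>), and \<open>\<Phi>\<close> preserves \<open>omega_N\<close> and these level
  sets.
\<close>

section \<open>Calculus in spaces with a finite frame\<close>

text \<open>The expansion property alone gives finite-dimensional calculus: it expresses a derivative
  through finitely many directional derivatives. It is inherited by products, whereas the spaces
  \<open>N\<close> and \<open>P\<close> contain an inner product space \<open>'e\<close> whose dimension may be zero and which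
  therefore comes without a canonical basis.\<close>

definition parseval_frame :: "'a::real_inner set \<Rightarrow> bool" where
  "parseval_frame B \<longleftrightarrow> finite B \<and> (\<forall>x. (\<Sum>b\<in>B. (x \<bullet> b) *\<^sub>R b) = x)"

lemma parseval_frameD:
  assumes "parseval_frame B"
  shows "finite B" and "(\<Sum>b\<in>B. (x \<bullet> b) *\<^sub>R b) = x"
  using assms by (auto simp: parseval_frame_def)

lemma parseval_frame_Basis: "parseval_frame (Basis :: 'a::euclidean_space set)"
  by (simp add: parseval_frame_def euclidean_representation)

lemma parseval_frame_prod:
  assumes "parseval_frame A" and "parseval_frame B"
  shows "parseval_frame ((\<lambda>a. (a, 0)) ` A \<union> (\<lambda>b. (0, b)) ` (B - {0}))"
proof -
  have fin: "finite A" "finite B"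
    using assms by (auto simp: parseval_frame_def)
  \<comment> \<open>The two embedded frames have to be disjoint, so the vector \<open>0\<close> is
    removed from one of them.\<close>
  have eqB: "(\<Sum>b\<in>B - {0}. (y \<bullet> b) *\<^sub>R b) = y" for y
    using parseval_frameD(2)[OF assms(2), of y] fin
    by (subst sum.mono_neutral_left[of B]) auto
  have "(\<Sum>c\<in>(\<lambda>a. (a, 0)) ` A \<union> (\<lambda>b. (0, b)) ` (B - {0}). ((x, y) \<bullet> c) *\<^sub>R c) = (x, y)" for x y
  proof -
    have "(\<Sum>c\<in>(\<lambda>a. (a, 0)) ` A \<union> (\<lambda>b. (0, b)) ` (B - {0}). ((x, y) \<bullet> c) *\<^sub>R c)
        = (\<Sum>c\<in>(\<lambda>a. (a, 0)) ` A. ((x, y) \<bullet> c) *\<^sub>R c) +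
          (\<Sum>c\<in>(\<lambda>b. (0, b)) ` (B - {0}). ((x, y) \<bullet> c) *\<^sub>R c)"
      using fin by (intro sum.union_disjoint) auto
    also have "\<dots> = (\<Sum>a\<in>A. ((x \<bullet> a) *\<^sub>R a, 0)) + (\<Sum>b\<in>B - {0}. (0, (y \<bullet> b) *\<^sub>R b))"
      by (subst (1 2) sum.reindex) (auto simp: inj_on_def)
    also have "\<dots> = (x, y)"
      using parseval_frameD(2)[OF assms(1), of x] eqB[of y] by (simp add: sum_prod prod_eq_iff fst_sum snd_sum)
    finally show ?thesis .
  qed
  then show ?thesis using fin by (auto simp: parseval_frame_def)
qed

lemma parseval_frame_orthonormal_basis:
  assumes "orthonormal_basis B" shows "parseval_frame B"
proof -
  have fin: "finite B" and orth: "pairwise orthogonal B" and n1: "\<forall>b\<in>B. norm b = 1"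
    and sp: "span B = UNIV"
    using assms by (auto simp: orthonormal_basis_def)
  have ip: "c \<bullet> b = (if c = b then 1 else 0)" if "b \<in> B" "c \<in> B" for b c
    using that orth n1 by (auto simp: pairwise_def orthogonal_def norm_eq_1)
  have "(\<Sum>b\<in>B. (x \<bullet> b) *\<^sub>R b) = x" for x
  proof -
    have "x \<in> span B" using sp by simp
    then show ?thesis
    proof (induction rule: span_induct_alt)
      case base
      then show ?case by simp
    next
      case (step c x y)
      have "(\<Sum>b\<in>B. (x \<bullet> b) *\<^sub>R b) = (\<Sum>b\<in>B. (if b = x then b else 0))"
        by (intro sum.cong) (auto simp: ip step)
      also have "\<dots> = x" using step fin by simp
      finally show ?case
        using step by (simp add: inner_add_left scaleR_add_left sum.distrib
            flip: scaleR_scaleR scaleR_sum_right)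
    qed
  qed
  then show ?thesis using fin by (simp add: parseval_frame_def)
qed

lemma linear_parseval:
  assumes "parseval_frame B" and "linear f"
  shows "(\<Sum>b\<in>B. (v \<bullet> b) *\<^sub>R f b) = f v"
  using assms linear_sum[OF assms(2), of "\<lambda>b. (v \<bullet> b) *\<^sub>R b" B]
  by (simp add: parseval_frameD linear_scale)

lemma inner_parseval:
  assumes "parseval_frame B"
  shows "(\<Sum>b\<in>B. (u \<bullet> b) * (v \<bullet> b)) = u \<bullet> v"
proof -
  have "(\<Sum>b\<in>B. (u \<bullet> b) * (v \<bullet> b)) = (\<Sum>b\<in>B. (u \<bullet> b) *\<^sub>R b) \<bullet> v"
    by (simp add: inner_sum_left inner_commute[of v])
  then show ?thesis using assms by (simp add: parseval_frameD)
qed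

text \<open>A frame spans, hence contains a basis \<open>C\<close>; the image of \<open>C\<close> is independent and of the
  same size, and a vector outside its span would enlarge it to an independent set with more than
  \<open>card C\<close> elements.\<close>

lemma linear_inj_imp_surj_parseval:
  fixes A :: "'a::real_inner \<Rightarrow> 'a"
  assumes "parseval_frame (E :: 'a set)" and "linear A" and "inj A"
  shows "surj A"
proof (rule ccontr)
  have spE: "span E = UNIV"
  proof -
    have "x \<in> span E" for x
      using parseval_frameD(2)[OF assms(1), of x] span_sum[of E "\<lambda>b. (x \<bullet> b) *\<^sub>R b" E]
      by (metis span_base span_scale)
    then show ?thesis by blast
  qed
  obtain C where C: "C \<subseteq> E" "independent C" "E \<subseteq> span C"
    using maximal_independent_subset[of E] by blast
  have fin: "finite C" using C assms(1) by (auto simp: parseval_frame_def intro: finite_subset)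
  have spC: "span C = UNIV"
    using C(3) spE span_mono[OF C(3)] by (metis span_span top.extremum_uniqueI)
  assume "\<not> surj A"
  then obtain y where y: "y \<notin> range A" by blast
  have "independent (A ` C)"
    using assms(2,3) C(2) by (metis linear_independent_injective_image inj_on_subset subset_UNIV)
  moreover have "y \<notin> span (A ` C)"
    using y linear_span_image[OF assms(2), of C] spC by auto
  ultimately have "independent (insert y (A ` C))" by (simp add: independent_insertI)
  then have "card (insert y (A ` C)) \<le> card C"
    using independent_span_bound[OF fin] spC by blast
  moreover have "y \<notin> A ` C" using y by blast
  moreover have "card (A ` C) = card C"
    using assms(3) by (metis card_image inj_on_subset subset_UNIV)
  ultimately show False using fin by simp
qed

lemma Ck_on_Suc_derivative:
  assumes "Ck_on (Suc k) S f" and "x \<in> S"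
  shows "(f has_derivative frechet_derivative f (at x)) (at x)"
  using assms by (simp add: frechet_derivative_works)

lemma Ck_on_SucD: "Ck_on (Suc k) S f \<Longrightarrow> Ck_on k S f"
proof (induction k arbitrary: f)
  case 0
  then show ?case
    by (auto intro!: continuous_at_imp_continuous_on differentiable_imp_continuous_within)
qed simp

lemma Ck_on_cong:
  assumes "open S" and "\<And>x. x \<in> S \<Longrightarrow> f x = g x" and "Ck_on k S f"
  shows "Ck_on k S g"
  using assms(2,3)
proof (induction k arbitrary: f g)
  case 0
  then show ?case by (auto cong: continuous_on_cong)
next
  case (Suc k)
  have "frechet_derivative f (at x) = frechet_derivative g (at x)" if "x \<in> S" for x
    using Suc that assms(1) by (intro frechet_derivative_transform_within_open) auto
  moreover have "g differentiable (at x)" if "x \<in> S" for x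
    using has_derivative_transform_within_open[OF Ck_on_Suc_derivative[OF Suc.prems(2) that] assms(1) that]
      Suc.prems(1) by (auto simp: differentiable_def)
  ultimately show ?case
    using Suc.prems(2) Suc.IH[of "\<lambda>x. frechet_derivative f (at x) v" "\<lambda>x. frechet_derivative g (at x) v" for v]
    by auto
qed

text \<open>The form in which all closure properties below are proved by induction on the order: a
  derivative is exhibited by the differentiation rules, and its values along a fixed direction are
  again built from maps of one order less.\<close>

lemma Ck_on_SucI:
  assumes "open S" and "\<And>x. x \<in> S \<Longrightarrow> (f has_derivative f' x) (at x)"
    and "\<And>v. Ck_on k S (\<lambda>x. f' x v)"
  shows "Ck_on (Suc k) S f"
proof -
  have "Ck_on k S (\<lambda>x. frechet_derivative f (at x) v)" for v
    using frechet_derivative_at[OF assms(2)]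
    by (intro Ck_on_cong[OF assms(1) _ assms(3)[of v]]) (auto dest: fun_cong)
  then show ?thesis using assms(2) by (auto simp: differentiable_def)
qed

lemma Ck_on_subset: "Ck_on k S f \<Longrightarrow> T \<subseteq> S \<Longrightarrow> Ck_on k T f"
  by (induction k arbitrary: f) (auto intro: continuous_on_subset)

text \<open>The map induced on \<open>P\<close> is known to be smooth only through local sections of \<open>psi\<close>.\<close>

lemma Ck_on_locally:
  assumes "\<And>x. x \<in> S \<Longrightarrow> \<exists>T. open T \<and> x \<in> T \<and> Ck_on k T f"
  shows "Ck_on k S f"
  using assms
proof (induction k arbitrary: f)
  case 0
  have "isCont f x" if "x \<in> S" for x
    using 0[OF that] continuous_on_eq_continuous_at by fastforce
  then show ?case by (auto intro: continuous_at_imp_continuous_on)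
next
  case (Suc k)
  have "Ck_on k S (\<lambda>x. frechet_derivative f (at x) v)" for v
    by (rule Suc.IH) (use Suc.prems in \<open>fastforce\<close>)
  then show ?case using Suc.prems by fastforce
qed

lemma Ck_on_const: "open S \<Longrightarrow> Ck_on k S (\<lambda>x. c)"
  by (induction k arbitrary: c) auto

lemma Ck_on_bounded_linear:
  assumes "open S" and "bounded_linear L" and "Ck_on k S f"
  shows "Ck_on k S (\<lambda>x. L (f x))"
  using assms(3)
proof (induction k arbitrary: f)
  case 0
  then show ?case using assms(2) by (simp add: bounded_linear.continuous_on)
next
  case (Suc k)
  show ?case
  proof (rule Ck_on_SucI[OF assms(1)])
    show "((\<lambda>x. L (f x)) has_derivative (\<lambda>v. L (frechet_derivative f (at x) v))) (at x)"
      if "x \<in> S" for x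
      by (rule bounded_linear.has_derivative[OF assms(2) Ck_on_Suc_derivative[OF Suc.prems that]])
  qed (use Suc in auto)
qed

lemma Ck_on_ident: "open S \<Longrightarrow> Ck_on k S (\<lambda>x. x)"
proof (cases k)
  case (Suc l)
  then show "open S \<Longrightarrow> Ck_on k S (\<lambda>x. x)" by (auto simp: Ck_on_const intro!: Ck_on_SucI[of _ _ "\<lambda>x v. v"])
qed simp

lemma Ck_on_add:
  assumes "open S" and "Ck_on k S f" and "Ck_on k S g"
  shows "Ck_on k S (\<lambda>x. f x + g x)"
  using assms(2,3)
proof (induction k arbitrary: f g)
  case 0
  then show ?case by (simp add: continuous_on_add)
next
  case (Suc k)
  show ?case
  proof (rule Ck_on_SucI[OF assms(1)])
    show "((\<lambda>x. f x + g x) has_derivative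
        (\<lambda>v. frechet_derivative f (at x) v + frechet_derivative g (at x) v)) (at x)"
      if "x \<in> S" for x
      by (intro has_derivative_add Ck_on_Suc_derivative[OF Suc.prems(1) that]
          Ck_on_Suc_derivative[OF Suc.prems(2) that])
  qed (use Suc in auto)
qed

lemma Ck_on_sum:
  assumes "open S" and "\<And>i. i \<in> I \<Longrightarrow> Ck_on k S (f i)"
  shows "Ck_on k S (\<lambda>x. \<Sum>i\<in>I. f i x)"
  using assms(2)
  by (induction I rule: infinite_finite_induct) (auto intro: Ck_on_const Ck_on_add assms(1))

lemma Ck_on_Pair:
  assumes "open S" and "Ck_on k S f" and "Ck_on k S g"
  shows "Ck_on k S (\<lambda>x. (f x, g x))"
proof -
  have "Ck_on k S (\<lambda>x. (f x, 0) + (0, g x))"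
    using assms
    by (intro Ck_on_add Ck_on_bounded_linear[of _ "\<lambda>y. (y, 0)"] Ck_on_bounded_linear[of _ "\<lambda>y. (0, y)"]
        bounded_linear_Pair bounded_linear_ident bounded_linear_zero) auto
  then show ?thesis by simp
qed

lemma Ck_on_vec_lambda:
  fixes f :: "'n::finite \<Rightarrow> 'a::real_normed_vector \<Rightarrow> 'b::euclidean_space"
  assumes S: "open S" and f: "\<And>j. Ck_on k S (f j)"
  shows "Ck_on k S (\<lambda>x. \<chi> j. f j x)"
proof -
  have "linear (axis j :: 'b \<Rightarrow> 'b ^ 'n)" for j
    by (rule linearI) (simp_all add: axis_def vec_eq_iff)
  then have "bounded_linear (axis j :: 'b \<Rightarrow> 'b ^ 'n)" for j by (simp add: linear_conv_bounded_linear)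
  then have "Ck_on k S (\<lambda>x. \<Sum>j\<in>UNIV. axis j (f j x) :: 'b ^ 'n)"
    by (intro Ck_on_sum S Ck_on_bounded_linear[OF S _ f])
  moreover have "(\<Sum>j\<in>UNIV. axis j (f j x)) = (\<chi> j. f j x)" for x
    by (simp add: vec_eq_iff axis_def)
  ultimately show ?thesis by simp
qed

lemma Ck_on_bilinear:
  assumes "open S" and "bounded_bilinear \<beta>" and "Ck_on k S f" and "Ck_on k S g"
  shows "Ck_on k S (\<lambda>x. \<beta> (f x) (g x))"
  using assms(3,4)
proof (induction k arbitrary: f g)
  case 0
  then show ?case using assms(2) by (simp add: bounded_bilinear.continuous_on)
next
  case (Suc k)
  show ?case
  proof (rule Ck_on_SucI[OF assms(1)])
    show "((\<lambda>x. \<beta> (f x) (g x)) has_derivative (\<lambda>v. \<beta> (f x) (frechet_derivative g (at x) v)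
        + \<beta> (frechet_derivative f (at x) v) (g x))) (at x)"
      if "x \<in> S" for x
      by (intro bounded_bilinear.FDERIV[OF assms(2)] Ck_on_Suc_derivative[OF Suc.prems(1) that]
          Ck_on_Suc_derivative[OF Suc.prems(2) that])
    show "Ck_on k S (\<lambda>x. \<beta> (f x) (frechet_derivative g (at x) v)
        + \<beta> (frechet_derivative f (at x) v) (g x))" for v
      using Suc Ck_on_SucD[of k S f] Ck_on_SucD[of k S g]
      by (intro Ck_on_add assms(1) Suc.IH) auto
  qed
qed

text \<open>The derivative of \<open>g\<close> at \<open>f x\<close> is applied to the varying vector \<open>f' x v\<close>, while the induction
  hypothesis only speaks of fixed directions; expanding \<open>f' x v\<close> in a frame of the intermediate
  space reduces the former to the latter.\<close>

lemma Ck_on_compose: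
  fixes f :: "'a::real_normed_vector \<Rightarrow> 'b::real_inner" and g :: "'b \<Rightarrow> 'c::real_normed_vector"
  assumes "open S" and "open T" and B: "parseval_frame (B :: 'b set)" and "f ` S \<subseteq> T"
    and "Ck_on k S f" and "Ck_on k T g"
  shows "Ck_on k S (\<lambda>x. g (f x))"
  using assms(5,6)
proof (induction k arbitrary: g)
  case 0
  then show ?case using assms(4) by (auto intro: continuous_on_compose2)
next
  case (Suc k)
  define f' where "f' x = frechet_derivative f (at x)" for x
  define g' where "g' y = frechet_derivative g (at y)" for y
  have f': "(f has_derivative f' x) (at x)" if "x \<in> S" for x
    using Ck_on_Suc_derivative[OF Suc.prems(1) that] by (simp add: f'_def)
  have g': "(g has_derivative g' (f x)) (at (f x))" if "x \<in> S" for x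
    using that assms(4) by (auto simp: g'_def intro!: Ck_on_Suc_derivative[OF Suc.prems(2)])
  show ?case
  proof (rule Ck_on_SucI[OF assms(1)])
    show "((\<lambda>x. g (f x)) has_derivative (\<lambda>v. \<Sum>b\<in>B. (f' x v \<bullet> b) *\<^sub>R g' (f x) b)) (at x)"
      if "x \<in> S" for x
      using diff_chain_at[OF f'[OF that] g'[OF that]] has_derivative_linear[OF g'[OF that]]
      by (simp add: linear_parseval[OF B] o_def)
    have "Ck_on k S (\<lambda>x. g' (f x) b)" for b
      using Suc.IH[of "\<lambda>y. g' y b"] Suc.prems Ck_on_SucD[OF Suc.prems(1)] by (simp add: g'_def)
    moreover have "Ck_on k S (\<lambda>x. f' x v)" for v
      using Suc.prems(1) by (simp add: f'_def)
    ultimately show "Ck_on k S (\<lambda>x. \<Sum>b\<in>B. (f' x v \<bullet> b) *\<^sub>R g' (f x) b)" for v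
      by (intro Ck_on_sum Ck_on_bilinear[OF _ bounded_bilinear_scaleR]
          Ck_on_bounded_linear[OF _ bounded_linear_inner_left] assms(1))
  qed
qed

lemma Ck_on_inverse_real: "Ck_on k (- {0}) (inverse :: real \<Rightarrow> real)"
proof (induction k)
  case 0
  then show ?case by (auto intro!: continuous_intros)
next
  case (Suc k)
  show ?case
  proof (rule Ck_on_SucI)
    show "(inverse has_derivative (\<lambda>v. - (inverse x * v * inverse x))) (at x)"
      if "x \<in> - {0}" for x :: real
      using that by (intro has_derivative_inverse') auto
    show "Ck_on k (- {0}) (\<lambda>x. - (inverse x * v * inverse x))" for v :: real
      by (intro Ck_on_bounded_linear[OF _ bounded_linear_minus[OF bounded_linear_ident]]
         Ck_on_bilinear[OF _ bounded_bilinear_mult] Suc Ck_on_const) auto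
  qed auto
qed

text \<open>Writing the derivative \<open>1 / (2 * sqrt x)\<close> as \<open>sqrt x / (2 * x)\<close> lets the induction hypothesis
  for \<open>sqrt\<close> and the smoothness of \<open>inverse\<close> apply.\<close>

lemma Ck_on_sqrt: "Ck_on k {0<..} sqrt"
proof (induction k)
  case 0
  then show ?case by (auto intro!: continuous_intros)
next
  case (Suc k)
  show ?case
  proof (rule Ck_on_SucI)
    show "(sqrt has_derivative (\<lambda>v. (v / 2) * (sqrt x * inverse x))) (at x)"
      if "x \<in> {0<..}" for x :: real
    proof -
      have "sqrt x * inverse x = inverse (sqrt x)"
        using that real_sqrt_mult_self[of x] by (auto simp: field_simps)
      then have "(*) (inverse (sqrt x) / 2) = (\<lambda>v. (v / 2) * (sqrt x * inverse x))"
        by (intro ext) simp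
      then show ?thesis
        using that DERIV_real_sqrt[of x] by (simp only: has_field_derivative_def greaterThan_iff)
    qed
    have "Ck_on k {0<..} (inverse :: real \<Rightarrow> real)"
      by (rule Ck_on_subset[OF Ck_on_inverse_real]) auto
    then show "Ck_on k {0<..} (\<lambda>x. (v / 2) * (sqrt x * inverse x))" for v :: real
      by (intro Ck_on_bilinear[OF _ bounded_bilinear_mult] Suc Ck_on_const) auto
  qed auto
qed

section \<open>Symmetry of second derivatives\<close>

text \<open>The mean value theorem along \<open>u\<close> for the increment of \<open>G\<close> in the direction \<open>v\<close>, and then
  along \<open>v\<close> for the derivative of \<open>G\<close> in the direction \<open>u\<close>. The left-hand side is symmetric in \<open>u\<close>
  and \<open>v\<close>; this is the source of the symmetry of second derivatives.\<close>

lemma mixed_difference_mean_value: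
  fixes G :: "'a::real_normed_vector \<Rightarrow> real"
  assumes "t > 0" and "\<And>a b. 0 \<le> a \<Longrightarrow> a \<le> t \<Longrightarrow> 0 \<le> b \<Longrightarrow> b \<le> t \<Longrightarrow> x + a *\<^sub>R u + b *\<^sub>R v \<in> S"
    and "\<And>y. y \<in> S \<Longrightarrow> (G has_derivative D y) (at y)"
    and "\<And>y. y \<in> S \<Longrightarrow> ((\<lambda>y. D y u) has_derivative E y) (at y)"
  shows "\<exists>a b. 0 < a \<and> a < t \<and> 0 < b \<and> b < t \<and>
    G (x + t *\<^sub>R u + t *\<^sub>R v) - G (x + t *\<^sub>R u) - G (x + t *\<^sub>R v) + G x
      = t * t * E (x + a *\<^sub>R u + b *\<^sub>R v) v"
proof -
  have D: "(G has_derivative D (x + a *\<^sub>R u + b *\<^sub>R v)) (at (x + a *\<^sub>R u + b *\<^sub>R v))"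
    if "0 \<le> a" "a \<le> t" "0 \<le> b" "b \<le> t" for a b
    using assms(2,3) that by blast
  have E: "((\<lambda>y. D y u) has_derivative E (x + a *\<^sub>R u + b *\<^sub>R v)) (at (x + a *\<^sub>R u + b *\<^sub>R v))"
    if "0 \<le> a" "a \<le> t" "0 \<le> b" "b \<le> t" for a b
    using assms(2,4) that by blast
  have shift_u: "((\<lambda>a. x + a *\<^sub>R u + b *\<^sub>R v) has_derivative (\<lambda>r. r *\<^sub>R u)) (at a within T)" for a b T
    by (auto intro!: derivative_eq_intros)
  have shift_v: "((\<lambda>b. x + a *\<^sub>R u + b *\<^sub>R v) has_derivative (\<lambda>r. r *\<^sub>R v)) (at b within T)" for a b T
    by (auto intro!: derivative_eq_intros)
  let ?\<phi> = "\<lambda>a. G (x + a *\<^sub>R u + t *\<^sub>R v) - G (x + a *\<^sub>R u + 0 *\<^sub>R v)"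
  have "\<exists>a\<in>{0<..<t}. ?\<phi> t - ?\<phi> 0
      = D (x + a *\<^sub>R u + t *\<^sub>R v) ((t - 0) *\<^sub>R u) - D (x + a *\<^sub>R u + 0 *\<^sub>R v) ((t - 0) *\<^sub>R u)"
  proof (rule mvt_simple[OF assms(1)])
    fix a assume "0 \<le> a" "a \<le> t"
    then have "0 \<le> a" "a \<le> t" "0 \<le> t" "t \<le> t" "(0::real) \<le> 0" by auto
    note h = has_derivative_compose[OF shift_u D[OF this(1,2,3,4)]]
      has_derivative_compose[OF shift_u D[OF this(1,2,5,3)]]
    show "(?\<phi> has_derivative (\<lambda>r. D (x + a *\<^sub>R u + t *\<^sub>R v) (r *\<^sub>R u) - D (x + a *\<^sub>R u + 0 *\<^sub>R v) (r *\<^sub>R u)))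
        (at a within {0..t})"
      by (intro has_derivative_diff h)
  qed
  then obtain a where a: "0 < a" "a < t" and 1: "?\<phi> t - ?\<phi> 0
      = D (x + a *\<^sub>R u + t *\<^sub>R v) (t *\<^sub>R u) - D (x + a *\<^sub>R u + 0 *\<^sub>R v) (t *\<^sub>R u)" by auto
  have "linear (D (x + a *\<^sub>R u + t *\<^sub>R v))" "linear (D (x + a *\<^sub>R u + 0 *\<^sub>R v))"
    using a D[of a t] D[of a 0] by (auto dest: has_derivative_linear)
  then have 2: "?\<phi> t - ?\<phi> 0 = t * (D (x + a *\<^sub>R u + t *\<^sub>R v) u - D (x + a *\<^sub>R u + 0 *\<^sub>R v) u)"
    using 1 by (simp only: linear_scale real_scaleR_def right_diff_distrib)
  have "\<exists>b\<in>{0<..<t}. D (x + a *\<^sub>R u + t *\<^sub>R v) u - D (x + a *\<^sub>R u + 0 *\<^sub>R v) u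
      = E (x + a *\<^sub>R u + b *\<^sub>R v) ((t - 0) *\<^sub>R v)"
  proof (rule mvt_simple[OF assms(1)])
    fix b assume b: "0 \<le> b" "b \<le> t"
    show "((\<lambda>b. D (x + a *\<^sub>R u + b *\<^sub>R v) u) has_derivative (\<lambda>r. E (x + a *\<^sub>R u + b *\<^sub>R v) (r *\<^sub>R v)))
        (at b within {0..t})"
      using a b by (intro has_derivative_compose[OF shift_v] E) auto
  qed
  then obtain b where b: "0 < b" "b < t" and 3: "D (x + a *\<^sub>R u + t *\<^sub>R v) u - D (x + a *\<^sub>R u + 0 *\<^sub>R v) u
      = E (x + a *\<^sub>R u + b *\<^sub>R v) (t *\<^sub>R v)" by auto
  have "linear (E (x + a *\<^sub>R u + b *\<^sub>R v))"
    using a b E[of a b] by (auto dest: has_derivative_linear)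
  then have "?\<phi> t - ?\<phi> 0 = t * t * E (x + a *\<^sub>R u + b *\<^sub>R v) v"
    using 2 3 by (simp add: linear_scale)
  then show ?thesis using a b by (intro exI[of _ a] exI[of _ b]) (simp add: algebra_simps)
qed

text \<open>Schwarz's theorem. If the two mixed derivatives differed at \<open>x\<close>, then by continuity they would
  do so at all pairs of points of a small parallelogram, whereas by
  \<open>mixed_difference_mean_value\<close> some value of the one equals some value of the other.\<close>

lemma frechet_derivative_symmetric:
  fixes G :: "'a::real_normed_vector \<Rightarrow> real"
  assumes "open S" and "x \<in> S" and "Ck_on 2 S G"
  shows "frechet_derivative (\<lambda>y. frechet_derivative G (at y) u) (at x) v
    = frechet_derivative (\<lambda>y. frechet_derivative G (at y) v) (at x) u"
proof (rule ccontr)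
  define D where "D y = frechet_derivative G (at y)" for y
  define E where "E w y = frechet_derivative (\<lambda>y. D y w) (at y)" for w y
  have C1: "Ck_on (Suc 1) S G" using assms(3) by (simp add: numeral_2_eq_2)
  have C2: "Ck_on (Suc 0) S (\<lambda>y. D y w)" for w
    using C1 by (simp add: D_def)
  have D: "(G has_derivative D y) (at y)" if "y \<in> S" for y
    using Ck_on_Suc_derivative[OF C1 that] by (simp add: D_def)
  have E: "((\<lambda>y. D y w) has_derivative E w y) (at y)" if "y \<in> S" for y w
    using Ck_on_Suc_derivative[OF C2 that] by (simp add: E_def)
  have cont: "continuous_on S (\<lambda>y. E w y w')" for w w'
    using C2[of w] by (simp add: E_def)
  assume "frechet_derivative (\<lambda>y. frechet_derivative G (at y) u) (at x) v
    \<noteq> frechet_derivative (\<lambda>y. frechet_derivative G (at y) v) (at x) u"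
  then have neq: "E u x v \<noteq> E v x u" by (simp add: E_def D_def)
  define e where "e = \<bar>E u x v - E v x u\<bar> / 2"
  have "e > 0" using neq by (simp add: e_def)
  define W where "W = {y \<in> S. dist (E u y v) (E u x v) < e} \<inter> {y \<in> S. dist (E v y u) (E v x u) < e}"
  have "W = ((\<lambda>y. E u y v) -` ball (E u x v) e \<inter> S) \<inter> ((\<lambda>y. E v y u) -` ball (E v x u) e \<inter> S)"
    by (auto simp: W_def dist_commute)
  then have "open W"
    using cont[of u v] cont[of v u] assms(1) by (simp add: continuous_on_open_vimage open_Int)
  moreover have "x \<in> W" using assms(2) \<open>e > 0\<close> by (simp add: W_def)
  ultimately obtain d where "d > 0" and d: "ball x d \<subseteq> W"
    using open_contains_ball by blast
  \<comment> \<open>Small enough for the parallelogram spanned by \<open>t u\<close> and \<open>t v\<close> to fit into the ball.\<close>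
  define t where "t = d / (2 * (norm u + norm v + 1))"
  have "t > 0" using \<open>d > 0\<close> by (simp add: t_def add_nonneg_pos)
  have box: "x + a *\<^sub>R u + b *\<^sub>R v \<in> W" if "0 \<le> a" "a \<le> t" "0 \<le> b" "b \<le> t" for a b
  proof -
    have "norm (a *\<^sub>R u + b *\<^sub>R v) \<le> a * norm u + b * norm v"
      using that norm_triangle_ineq[of "a *\<^sub>R u" "b *\<^sub>R v"] by simp
    also have "\<dots> \<le> t * norm u + t * norm v"
      using that by (intro add_mono mult_right_mono) auto
    also have "\<dots> \<le> t * (norm u + norm v + 1)" using \<open>t > 0\<close> by (simp add: algebra_simps)
    also have "\<dots> = d / 2"
      using add_nonneg_pos[of "norm u + norm v" 1] by (simp add: t_def field_simps)
    finally have "norm (a *\<^sub>R u + b *\<^sub>R v) < d" using \<open>d > 0\<close> by simp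
    moreover have "dist x (x + a *\<^sub>R u + b *\<^sub>R v) = norm (a *\<^sub>R u + b *\<^sub>R v)"
      by (simp add: dist_norm norm_minus_commute flip: norm_minus_cancel[of "a *\<^sub>R u + b *\<^sub>R v"])
    ultimately show ?thesis using d by (auto simp: subset_iff)
  qed
  have WS: "W \<subseteq> S" by (auto simp: W_def)
  obtain a b where ab: "0 < a" "a < t" "0 < b" "b < t" and 1:
    "G (x + t *\<^sub>R u + t *\<^sub>R v) - G (x + t *\<^sub>R u) - G (x + t *\<^sub>R v) + G x
      = t * t * E u (x + a *\<^sub>R u + b *\<^sub>R v) v"
    using mixed_difference_mean_value[OF \<open>t > 0\<close>, of x u v S G D "E u"] box WS D E by blast
  have box': "x + a *\<^sub>R v + b *\<^sub>R u \<in> S" if "0 \<le> a" "a \<le> t" "0 \<le> b" "b \<le> t" for a b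
    using box[OF that(3,4,1,2)] WS by (auto simp: algebra_simps)
  obtain a' b' where ab': "0 < a'" "a' < t" "0 < b'" "b' < t" and 2:
    "G (x + t *\<^sub>R v + t *\<^sub>R u) - G (x + t *\<^sub>R v) - G (x + t *\<^sub>R u) + G x
      = t * t * E v (x + a' *\<^sub>R v + b' *\<^sub>R u) u"
    using mixed_difference_mean_value[OF \<open>t > 0\<close>, of x v u S G D "E v"] box' D E by blast
  have "t * t * E u (x + a *\<^sub>R u + b *\<^sub>R v) v = t * t * E v (x + b' *\<^sub>R u + a' *\<^sub>R v) u"
    using 1 2 by (simp add: algebra_simps)
  then have eq: "E u (x + a *\<^sub>R u + b *\<^sub>R v) v = E v (x + b' *\<^sub>R u + a' *\<^sub>R v) u"
    using \<open>t > 0\<close> by simp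
  have "\<bar>E u (x + a *\<^sub>R u + b *\<^sub>R v) v - E u x v\<bar> < e"
    using box[of a b] ab by (auto simp: W_def dist_real_def)
  moreover have "\<bar>E v (x + b' *\<^sub>R u + a' *\<^sub>R v) u - E v x u\<bar> < e"
    using box[of b' a'] ab' by (auto simp: W_def dist_real_def)
  ultimately have "\<bar>E u x v - E v x u\<bar> < 2 * e" using eq by linarith
  then show False by (simp add: e_def)
qed

section \<open>Symplectic linear algebra\<close>

definition mult_i :: "(complex ^ 'n::finite) \<times> (complex ^ 'n) \<Rightarrow> (complex ^ 'n) \<times> (complex ^ 'n)" where
  "mult_i z = ((\<chi> j. \<i> * fst z $ j), (\<chi> j. \<i> * snd z $ j))"

text \<open>The isometry with square \<open>-1\<close> that turns the symplectic form into the inner product, see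
  \<open>omega_N_eq_inner\<close>.\<close>

definition complex_structure :: "('n::finite, 'e::real_inner) N \<Rightarrow> ('n, 'e) N" where
  "complex_structure x = (mult_i (fst x), - snd (snd x), fst (snd x))"

lemma linear_mult_i: "linear mult_i"
  by (rule linearI) (auto simp: mult_i_def vec_eq_iff algebra_simps)

lemma inner_mult_i: "fst z \<bullet> fst (mult_i u) + snd z \<bullet> snd (mult_i u) =
   (\<Sum>j\<in>UNIV. Im (fst z $ j) * Re (fst u $ j) - Re (fst z $ j) * Im (fst u $ j)) +
   (\<Sum>j\<in>UNIV. Im (snd z $ j) * Re (snd u $ j) - Re (snd z $ j) * Im (snd u $ j))"
  by (simp add: mult_i_def inner_vec_def inner_complex_def algebra_simps)

lemma omega_N_split:
  assumes "orthonormal_basis B"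
  shows "omega_N B u v = fst u \<bullet> mult_i (fst v)
    + snd (snd u) \<bullet> fst (snd v) - fst (snd u) \<bullet> snd (snd v)"
proof -
  obtain u1 u2 up uq where u: "u = ((u1, u2), up, uq)" by (metis prod.exhaust)
  obtain v1 v2 vp vq where v: "v = ((v1, v2), vp, vq)" by (metis prod.exhaust)
  show ?thesis
    using inner_mult_i[of "(u1, u2)" "(v1, v2)"]
      inner_parseval[OF parseval_frame_orthonormal_basis[OF assms]]
    by (simp add: u v omega_N_def inner_prod_def sum_subtractf)
qed

lemma omega_N_eq_inner:
  assumes "orthonormal_basis B"
  shows "omega_N B u v = u \<bullet> complex_structure v"
  by (simp add: omega_N_split[OF assms] complex_structure_def inner_prod_def)

lemma complex_structure_twice: "complex_structure (complex_structure v) = - v"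
  by (simp add: complex_structure_def mult_i_def prod_eq_iff vec_eq_iff)

lemma linear_complex_structure: "linear complex_structure"
  by (rule linearI) (simp_all add: complex_structure_def linear_add[OF linear_mult_i] linear_scale[OF linear_mult_i])

lemma omega_N_antisym:
  assumes "orthonormal_basis B"
  shows "omega_N B u v = - omega_N B v u"
proof -
  have "fst u \<bullet> mult_i (fst v) = - (fst v \<bullet> mult_i (fst u))"
    by (simp only: inner_prod_def inner_mult_i) (simp add: sum_subtractf mult.commute)
  then show ?thesis by (simp add: omega_N_split[OF assms] inner_commute)
qed

lemma omega_N_nondegenerate:
  assumes "orthonormal_basis B" and "\<And>v. omega_N B u v = omega_N B w v"
  shows "u = w"
proof -
  have "u \<bullet> c = w \<bullet> c" for c
    using assms(2)[of "- complex_structure c"]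
    by (simp add: omega_N_eq_inner[OF assms(1)] linear_neg[OF linear_complex_structure]
        complex_structure_twice)
  then show ?thesis using vector_eq_rdot by blast
qed

text \<open>The vector that represents the linear form \<open>g\<close> with respect to the symplectic form, so that
  Hamiltonian vector fields are the duals of differentials (\<open>hamiltonian_vector_field_eq\<close>).\<close>

definition hamiltonian_dual ::
  "'e::real_inner set \<Rightarrow> (('n::finite, 'e) N \<Rightarrow> real) \<Rightarrow> ('n, 'e) N" where
  "hamiltonian_dual B g =
     (\<Sum>j\<in>UNIV. g ((axis j 1, 0), 0, 0) *\<^sub>R ((axis j \<i>, 0), 0, 0)
       + (- g ((axis j \<i>, 0), 0, 0)) *\<^sub>R ((axis j 1, 0), 0, 0)) +
     (\<Sum>j\<in>UNIV. g ((0, axis j 1), 0, 0) *\<^sub>R ((0, axis j \<i>), 0, 0)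
       + (- g ((0, axis j \<i>), 0, 0)) *\<^sub>R ((0, axis j 1), 0, 0)) +
     (\<Sum>b\<in>B. g (0, b, 0) *\<^sub>R (0, 0, b) + (- g (0, 0, b)) *\<^sub>R (0, b, 0))"

lemma axis_decompose: "(\<Sum>j\<in>UNIV. Re (v $ j) *\<^sub>R axis j 1 + Im (v $ j) *\<^sub>R axis j \<i>) = (v :: complex ^ 'n::finite)"
proof -
  have "Re (v $ j) *\<^sub>R axis j 1 + Im (v $ j) *\<^sub>R axis j \<i> = axis j (v $ j)" for j
    by (auto simp: vec_eq_iff axis_def complex_eq_iff)
  then show ?thesis by (simp add: vec_eq_iff axis_def)
qed

lemma omega_N_hamiltonian_dual:
  fixes g :: "('n::finite, 'e::real_inner) N \<Rightarrow> real"
  assumes B: "orthonormal_basis B" and g: "linear g"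
  shows "omega_N B (hamiltonian_dual B g) v = g v"
proof -
  obtain v1 v2 vp vq where v: "v = ((v1, v2), vp, vq)" by (metis prod.exhaust)
  note inn = omega_N_eq_inner[OF B]
  have ax: "axis j c \<bullet> w = c \<bullet> w $ j" for j and c :: complex and w :: "complex ^ 'n"
    by (metis inner_axis inner_commute)
  have "(\<Sum>j\<in>UNIV. g ((axis j 1, 0), 0, 0) * Re (v1 $ j) + g ((axis j \<i>, 0), 0, 0) * Im (v1 $ j))
      = g (\<Sum>j\<in>UNIV. Re (v1 $ j) *\<^sub>R ((axis j 1, 0), 0, 0) + Im (v1 $ j) *\<^sub>R ((axis j \<i>, 0), 0, 0))"
    by (simp only: linear_sum[OF g] linear_add[OF g] linear_scale[OF g] real_scaleR_def mult.commute)
  also have "(\<Sum>j\<in>UNIV. Re (v1 $ j) *\<^sub>R ((axis j 1, 0), 0, 0) + Im (v1 $ j) *\<^sub>R ((axis j \<i>, 0), 0, 0))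
      = ((v1, 0), 0 :: 'e, 0 :: 'e)"
    using axis_decompose[of v1] by (simp add: prod_eq_iff fst_sum snd_sum)
  finally have 1: "(\<Sum>j\<in>UNIV. g ((axis j 1, 0), 0, 0) * Re (v1 $ j) + g ((axis j \<i>, 0), 0, 0) * Im (v1 $ j))
     = g ((v1, 0), 0, 0)" .
  have "(\<Sum>j\<in>UNIV. g ((0, axis j 1), 0, 0) * Re (v2 $ j) + g ((0, axis j \<i>), 0, 0) * Im (v2 $ j))
      = g (\<Sum>j\<in>UNIV. Re (v2 $ j) *\<^sub>R ((0, axis j 1), 0, 0) + Im (v2 $ j) *\<^sub>R ((0, axis j \<i>), 0, 0))"
    by (simp only: linear_sum[OF g] linear_add[OF g] linear_scale[OF g] real_scaleR_def mult.commute)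
  also have "(\<Sum>j\<in>UNIV. Re (v2 $ j) *\<^sub>R ((0, axis j 1), 0, 0) + Im (v2 $ j) *\<^sub>R ((0, axis j \<i>), 0, 0))
      = ((0, v2), 0 :: 'e, 0 :: 'e)"
    using axis_decompose[of v2] by (simp add: prod_eq_iff fst_sum snd_sum)
  finally have 2: "(\<Sum>j\<in>UNIV. g ((0, axis j 1), 0, 0) * Re (v2 $ j) + g ((0, axis j \<i>), 0, 0) * Im (v2 $ j))
     = g ((0, v2), 0, 0)" .
  have "(\<Sum>b\<in>B. g (0, b, 0) * (b \<bullet> vp) + g (0, 0, b) * (b \<bullet> vq))
     = g (\<Sum>b\<in>B. (vp \<bullet> b) *\<^sub>R (0, b, 0) + (vq \<bullet> b) *\<^sub>R (0, 0, b))"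
    by (simp only: linear_sum[OF g] linear_add[OF g] linear_scale[OF g] real_scaleR_def mult.commute
        inner_commute)
  also have "(\<Sum>b\<in>B. (vp \<bullet> b) *\<^sub>R (0, b, 0) + (vq \<bullet> b) *\<^sub>R (0, 0, b)) = ((0 :: complex ^ 'n, 0 :: complex ^ 'n), vp, vq)"
    using parseval_frameD(2)[OF parseval_frame_orthonormal_basis[OF B]]
    by (simp add: prod_eq_iff fst_sum snd_sum)
  finally have 3: "(\<Sum>b\<in>B. g (0, b, 0) * (b \<bullet> vp) + g (0, 0, b) * (b \<bullet> vq)) = g ((0, 0), vp, vq)" .
  have "omega_N B (hamiltonian_dual B g) v
      = (\<Sum>j\<in>UNIV. g ((axis j 1, 0), 0, 0) * Re (v1 $ j) + g ((axis j \<i>, 0), 0, 0) * Im (v1 $ j))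
      + (\<Sum>j\<in>UNIV. g ((0, axis j 1), 0, 0) * Re (v2 $ j) + g ((0, axis j \<i>), 0, 0) * Im (v2 $ j))
      + (\<Sum>b\<in>B. g (0, b, 0) * (b \<bullet> vp) + g (0, 0, b) * (b \<bullet> vq))"
    unfolding inn hamiltonian_dual_def v complex_structure_def mult_i_def
    by (simp add: inner_sum_left inner_add_left inner_diff_left ax inner_complex_def zero_prod_def
        sum.distrib)
  also have "\<dots> = g (((v1, 0), 0, 0) + ((0, v2), 0, 0) + ((0, 0), vp, vq))"
    unfolding 1 2 3 by (simp only: linear_add[OF g])
  also have "\<dots> = g v" by (simp add: v)
  finally show ?thesis .
qed

lemma bracket_N_eq:
  assumes "F differentiable (at x)"
  shows "bracket_N B F G x
    = frechet_derivative F (at x) (hamiltonian_dual B (frechet_derivative G (at x)))"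
proof -
  have l: "linear (frechet_derivative F (at x))"
    using assms by (simp add: linear_frechet_derivative)
  show ?thesis
    unfolding hamiltonian_dual_def bracket_N_def Let_def
    by (simp only: linear_sum[OF l] linear_add[OF l] linear_scale[OF l] real_scaleR_def)
       (simp add: mult.commute)
qed

lemma hamiltonian_dual_unique:
  assumes "orthonormal_basis B" and "linear g" and "\<And>v. omega_N B u v = g v"
  shows "u = hamiltonian_dual B g"
  using assms by (intro omega_N_nondegenerate[OF assms(1)]) (simp add: omega_N_hamiltonian_dual)

lemma parseval_frame_N:
  assumes "orthonormal_basis (B :: 'e::real_inner set)"
  shows "\<exists>E. parseval_frame (E :: ('n::finite, 'e) N set)"
  using parseval_frame_prod[OF parseval_frame_Basis parseval_frame_prod]
    parseval_frame_orthonormal_basis[OF assms] by blast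

lemma parseval_frame_P:
  assumes "orthonormal_basis (B :: 'e::real_inner set)"
  shows "\<exists>E. parseval_frame (E :: ('n::finite, 'e) P set)"
  using parseval_frame_prod[OF parseval_frame_Basis parseval_frame_prod]
    parseval_frame_orthonormal_basis[OF assms] by blast

text \<open>A linear map \<open>A\<close> that preserves the symplectic form is injective because the form is
  nondegenerate, hence surjective, and so the identity \<open>\<omega>(A u, A v) = \<omega>(u, v) = g (A v)\<close> for the dual
  \<open>u\<close> of \<open>g \<circ> A\<close> determines \<open>A u\<close>. This is used for the derivative of the method, to pass from
  symplectic to Poisson, and for rotations, to see that the vector field is equivariant.\<close>

lemma hamiltonian_dual_pushforward:
  fixes A :: "('n::finite, 'e::real_inner) N \<Rightarrow> ('n, 'e) N"
  assumes B: "orthonormal_basis B" and A: "linear A" and g: "linear g"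
    and sympl: "\<And>u v. omega_N B (A u) (A v) = omega_N B u v"
  shows "A (hamiltonian_dual B (\<lambda>v. g (A v))) = hamiltonian_dual B g"
proof (rule hamiltonian_dual_unique[OF B g])
  have gA: "linear (\<lambda>v. g (A v))"
    using linear_compose[OF A g] by (simp add: o_def)
  have "inj A"
  proof (rule injI)
    fix u w assume "A u = A w"
    then show "u = w"
      using sympl[of u] sympl[of w] by (intro omega_N_nondegenerate[OF B]) metis
  qed
  then have "surj A"
    using parseval_frame_N[OF B] A by (metis linear_inj_imp_surj_parseval)
  fix w
  \<comment> \<open>Surjectivity is what allows testing against the vectors \<open>A v\<close> only.\<close>
  from \<open>surj A\<close> obtain v where w: "w = A v" by (metis surjE)
  show "omega_N B (A (hamiltonian_dual B (\<lambda>v. g (A v)))) w = g w"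
    by (simp add: w sympl omega_N_hamiltonian_dual[OF B gA])
qed

section \<open>Hamiltonian vector fields\<close>

text \<open>The defining property is tested on the linear functions \<open>y \<mapsto> y \<bullet> c\<close>, which already determine
  the vector.\<close>

lemma hamiltonian_vector_field_eq:
  assumes B: "orthonormal_basis B" and S: "open S"
    and X: "hamiltonian_vector_field_on B S G X" and "x \<in> S"
  shows "X x = hamiltonian_dual B (frechet_derivative G (at x))"
proof -
  have "X x \<bullet> c = hamiltonian_dual B (frechet_derivative G (at x)) \<bullet> c" for c
  proof -
    have "smooth_on S (\<lambda>y. y \<bullet> c)" (is "smooth_on S ?F")
      unfolding smooth_on_def
      by (auto intro!: Ck_on_bounded_linear[OF S bounded_linear_inner_left] Ck_on_ident S)
    then have "frechet_derivative ?F (at x) (X x) = bracket_N B ?F G x"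
      using X \<open>x \<in> S\<close> unfolding hamiltonian_vector_field_on_def by blast
    moreover have d: "((\<lambda>y. y \<bullet> c) has_derivative (\<lambda>v. v \<bullet> c)) (at x)"
      by (auto intro!: derivative_eq_intros)
    moreover have "(\<lambda>y. y \<bullet> c) differentiable (at x)"
      using d by (auto simp: differentiable_def)
    ultimately show ?thesis
      using bracket_N_eq[of ?F x B G] frechet_derivative_at[OF d, symmetric] by simp
  qed
  then show ?thesis using vector_eq_rdot by blast
qed

lemma Ck_on_hamiltonian_vector_field:
  assumes B: "orthonormal_basis B" and S: "open S"
    and X: "hamiltonian_vector_field_on B S G X" and "smooth_on S G"
  shows "Ck_on k S X"
proof -
  have G: "Ck_on k S (\<lambda>x. frechet_derivative G (at x) v)" for v
    using assms(4) by (metis smooth_on_def Ck_on.simps(2))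
  have G': "Ck_on k S (\<lambda>x. frechet_derivative G (at x) v *\<^sub>R w)" for v and w :: "('b, 'a) N"
    by (intro Ck_on_bounded_linear[OF S bounded_linear_scaleR_left] G)
  have G'': "Ck_on k S (\<lambda>x. (- frechet_derivative G (at x) v) *\<^sub>R w)" for v and w :: "('b, 'a) N"
    by (intro Ck_on_bounded_linear[OF S bounded_linear_scaleR_left] G
        Ck_on_bounded_linear[OF S bounded_linear_minus[OF bounded_linear_ident]])
  have "Ck_on k S (\<lambda>x. hamiltonian_dual B (frechet_derivative G (at x)))"
    unfolding hamiltonian_dual_def by (intro Ck_on_add Ck_on_sum S G' G'')
  then show ?thesis
    by (rule Ck_on_cong[OF S, rotated]) (simp add: hamiltonian_vector_field_eq[OF B S X])
qed

text \<open>The linearization of a Hamiltonian vector field is infinitesimally symplectic: since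
  \<open>\<omega>(X y, b)\<close> is the derivative of \<open>G\<close> at \<open>y\<close> along \<open>b\<close>, the form \<open>\<omega>(X' a, b)\<close> is the Hessian
  of \<open>G\<close>, which is symmetric.\<close>

lemma hamiltonian_linearization_skew:
  assumes B: "orthonormal_basis B" and S: "open S"
    and X: "hamiltonian_vector_field_on B S G X" and G: "smooth_on S G" and "y \<in> S"
    and X': "(X has_derivative X') (at y)"
  shows "omega_N B a (X' b) + omega_N B (X' a) b = 0"
proof -
  have Gd: "(G has_derivative frechet_derivative G (at x)) (at x)" if "x \<in> S" for x
    using G that by (intro Ck_on_Suc_derivative[of 0 S]) (simp_all only: smooth_on_def)
  have eq: "omega_N B (X' a) b = frechet_derivative (\<lambda>y. frechet_derivative G (at y) b) (at y) a" for a b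
  proof -
    have "((\<lambda>y. X y \<bullet> complex_structure b) has_derivative (\<lambda>a. X' a \<bullet> complex_structure b)) (at y)"
      by (rule has_derivative_inner_left[OF X'])
    then have "((\<lambda>y. frechet_derivative G (at y) b) has_derivative (\<lambda>a. X' a \<bullet> complex_structure b)) (at y)"
      using S \<open>y \<in> S\<close>
    proof (rule has_derivative_transform_within_open)
      show "X x \<bullet> complex_structure b = frechet_derivative G (at x) b" if "x \<in> S" for x
        using omega_N_hamiltonian_dual[OF B has_derivative_linear[OF Gd[OF that]]]
        by (simp add: hamiltonian_vector_field_eq[OF B S X that] omega_N_eq_inner[OF B])
    qed
    from fun_cong[OF frechet_derivative_at[OF this], of a] show ?thesis
      by (simp only: omega_N_eq_inner[OF B])
  qed
  have "omega_N B (X' a) b = omega_N B (X' b) a"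
    unfolding eq using G by (intro frechet_derivative_symmetric[OF S \<open>y \<in> S\<close>]) (simp only: smooth_on_def)
  then show ?thesis using omega_N_antisym[OF B, of a "X' b"] by simp
qed

section \<open>Symplectic partitioned Runge--Kutta methods\<close>

text \<open>The mechanism behind all conservation laws of symplectic Runge--Kutta methods, stated for a
  pairing of two quantities that may be integrated with different coefficients. Expanding the
  left-hand side gives \<open>\<beta> u v\<close>, terms linear in \<open>h\<close>, and the double sum of
  \<open>b i * c j * \<beta> (K i) (L j)\<close>. Replacing \<open>u\<close> by \<open>A i\<close> and \<open>v\<close> by \<open>C i\<close> in the linear terms produces
  exactly that double sum, by the relation between the coefficients. The pairing is thus
  conserved as soon as the stagewise terms on the right cancel.\<close>

lemma rk_bilinear_increment:
  fixes \<beta> :: "'a::real_vector \<Rightarrow> 'b::real_vector \<Rightarrow> real"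
  assumes \<beta>: "bilinear \<beta>"
    and coeff: "\<And>i j. i \<in> I \<Longrightarrow> j \<in> I \<Longrightarrow> b i * c j = b i * d i j + c j * a j i"
    and A: "\<And>i. i \<in> I \<Longrightarrow> A i = u + h *\<^sub>R (\<Sum>j\<in>I. a i j *\<^sub>R K j)"
    and C: "\<And>i. i \<in> I \<Longrightarrow> C i = v + h *\<^sub>R (\<Sum>j\<in>I. d i j *\<^sub>R L j)"
  shows "\<beta> (u + h *\<^sub>R (\<Sum>i\<in>I. b i *\<^sub>R K i)) (v + h *\<^sub>R (\<Sum>i\<in>I. c i *\<^sub>R L i))
    = \<beta> u v + h * (\<Sum>i\<in>I. c i * \<beta> (A i) (L i) + b i * \<beta> (K i) (C i))"
proof -
  have l: "linear (\<lambda>x. \<beta> x y)" and r: "linear (\<beta> x)" for x y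
    using \<beta> by (auto simp: bilinear_def)
  note ls = linear_add[OF l] linear_scale[OF l] linear_sum[OF l]
    linear_add[OF r] linear_scale[OF r] linear_sum[OF r]
  have cc: "(\<Sum>i\<in>I. \<Sum>j\<in>I. b i * c j * \<beta> (K i) (L j))
      = (\<Sum>i\<in>I. \<Sum>j\<in>I. b i * d i j * \<beta> (K i) (L j)) + (\<Sum>i\<in>I. \<Sum>j\<in>I. c i * a i j * \<beta> (K j) (L i))"
  proof -
    have "(\<Sum>i\<in>I. \<Sum>j\<in>I. b i * c j * \<beta> (K i) (L j))
      = (\<Sum>i\<in>I. \<Sum>j\<in>I. b i * d i j * \<beta> (K i) (L j) + c j * a j i * \<beta> (K i) (L j))"
      by (intro sum.cong refl) (simp add: coeff distrib_right)
    also have "\<dots> = (\<Sum>i\<in>I. \<Sum>j\<in>I. b i * d i j * \<beta> (K i) (L j)) + (\<Sum>i\<in>I. \<Sum>j\<in>I. c j * a j i * \<beta> (K i) (L j))"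
      by (simp add: sum.distrib)
    also have "(\<Sum>i\<in>I. \<Sum>j\<in>I. c j * a j i * \<beta> (K i) (L j)) = (\<Sum>i\<in>I. \<Sum>j\<in>I. c i * a i j * \<beta> (K j) (L i))"
      by (rule sum.swap)
    finally show ?thesis .
  qed
  have 1: "(\<Sum>i\<in>I. c i * \<beta> (A i) (L i))
      = (\<Sum>i\<in>I. c i * \<beta> u (L i)) + h * (\<Sum>i\<in>I. \<Sum>j\<in>I. c i * a i j * \<beta> (K j) (L i))"
    by (simp add: A ls sum.distrib sum_distrib_left algebra_simps)
  have 2: "(\<Sum>i\<in>I. b i * \<beta> (K i) (C i))
      = (\<Sum>i\<in>I. b i * \<beta> (K i) v) + h * (\<Sum>i\<in>I. \<Sum>j\<in>I. b i * d i j * \<beta> (K i) (L j))"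
    by (simp add: C ls sum.distrib sum_distrib_left algebra_simps)
  have "\<beta> (u + h *\<^sub>R (\<Sum>i\<in>I. b i *\<^sub>R K i)) (v + h *\<^sub>R (\<Sum>i\<in>I. c i *\<^sub>R L i))
      = \<beta> u v + h * (\<Sum>i\<in>I. c i * \<beta> u (L i)) + h * (\<Sum>i\<in>I. b i * \<beta> (K i) v)
        + h * (h * (\<Sum>i\<in>I. \<Sum>j\<in>I. b i * c j * \<beta> (K i) (L j)))"
    by (simp add: ls sum_distrib_left sum.distrib algebra_simps) (rule sum.swap)
  then show ?thesis unfolding cc sum.distrib 1 2 by (simp add: algebra_simps)
qed

text \<open>The variational equation: the derivatives of the stages solve the same equations for the
  linearized vector field, so that \<open>rk_bilinear_increment\<close> applies to them.\<close>

lemma prk_stages_derivative: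
  fixes f :: "'z::real_normed_vector \<times> 'p::real_normed_vector \<times> 'q::real_normed_vector \<Rightarrow> 'z \<times> 'p \<times> 'q"
  assumes "open U" and "x \<in> U" and "\<And>x. x \<in> U \<Longrightarrow> prk_stages s az ap aq h f D x (Y x)"
    and Y': "\<And>i. i \<in> {1..s} \<Longrightarrow> ((\<lambda>x. Y x i) has_derivative Y' i) (at x)"
    and f': "\<And>i. i \<in> {1..s} \<Longrightarrow> (f has_derivative f' i) (at (Y x i))"
    and "i \<in> {1..s}"
  shows "Y' i u = (fst u + h *\<^sub>R (\<Sum>j=1..s. az i j *\<^sub>R fst (f' j (Y' j u))),
               fst (snd u) + h *\<^sub>R (\<Sum>j=1..s. ap i j *\<^sub>R fst (snd (f' j (Y' j u)))),
               snd (snd u) + h *\<^sub>R (\<Sum>j=1..s. aq i j *\<^sub>R snd (snd (f' j (Y' j u)))))"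
proof -
  have K: "((\<lambda>x. f (Y x j)) has_derivative (\<lambda>u. f' j (Y' j u))) (at x)" if "j \<in> {1..s}" for j
    using has_derivative_compose[OF Y' f'] that by blast
  have eq: "Y x i = (fst x + h *\<^sub>R (\<Sum>j=1..s. az i j *\<^sub>R fst (f (Y x j))),
               fst (snd x) + h *\<^sub>R (\<Sum>j=1..s. ap i j *\<^sub>R fst (snd (f (Y x j)))),
               snd (snd x) + h *\<^sub>R (\<Sum>j=1..s. aq i j *\<^sub>R snd (snd (f (Y x j)))))" if "x \<in> U" for x
    using assms(3)[OF that] \<open>i \<in> {1..s}\<close> unfolding prk_stages_def by blast
  have "((\<lambda>x. (fst x + h *\<^sub>R (\<Sum>j=1..s. az i j *\<^sub>R fst (f (Y x j))),
               fst (snd x) + h *\<^sub>R (\<Sum>j=1..s. ap i j *\<^sub>R fst (snd (f (Y x j)))),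
               snd (snd x) + h *\<^sub>R (\<Sum>j=1..s. aq i j *\<^sub>R snd (snd (f (Y x j))))))
      has_derivative (\<lambda>u. (fst u + h *\<^sub>R (\<Sum>j=1..s. az i j *\<^sub>R fst (f' j (Y' j u))),
               fst (snd u) + h *\<^sub>R (\<Sum>j=1..s. ap i j *\<^sub>R fst (snd (f' j (Y' j u)))),
               snd (snd u) + h *\<^sub>R (\<Sum>j=1..s. aq i j *\<^sub>R snd (snd (f' j (Y' j u))))))) (at x)"
    by (intro has_derivative_Pair has_derivative_add has_derivative_scaleR_right has_derivative_sum
        has_derivative_fst has_derivative_snd has_derivative_ident K)
  then have "((\<lambda>x. Y x i) has_derivative (\<lambda>u. (fst u + h *\<^sub>R (\<Sum>j=1..s. az i j *\<^sub>R fst (f' j (Y' j u))),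
               fst (snd u) + h *\<^sub>R (\<Sum>j=1..s. ap i j *\<^sub>R fst (snd (f' j (Y' j u)))),
               snd (snd u) + h *\<^sub>R (\<Sum>j=1..s. aq i j *\<^sub>R snd (snd (f' j (Y' j u))))))) (at x)"
    using assms(1,2)
    by (rule has_derivative_transform_within_open) (erule eq[symmetric])
  from has_derivative_unique[OF Y'[OF \<open>i \<in> {1..s}\<close>] this] show ?thesis by metis
qed

lemma prk_update_derivative:
  fixes f :: "'z::real_normed_vector \<times> 'p::real_normed_vector \<times> 'q::real_normed_vector \<Rightarrow> 'z \<times> 'p \<times> 'q"
  assumes "open U" and "x \<in> U" and "\<And>x. x \<in> U \<Longrightarrow> \<Phi> x = prk_update s bz bp bq h f x (Y x)"
    and Y': "\<And>i. i \<in> {1..s} \<Longrightarrow> ((\<lambda>x. Y x i) has_derivative Y' i) (at x)"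
    and f': "\<And>i. i \<in> {1..s} \<Longrightarrow> (f has_derivative f' i) (at (Y x i))"
  shows "(\<Phi> has_derivative (\<lambda>u. (fst u + h *\<^sub>R (\<Sum>i=1..s. bz i *\<^sub>R fst (f' i (Y' i u))),
               fst (snd u) + h *\<^sub>R (\<Sum>i=1..s. bp i *\<^sub>R fst (snd (f' i (Y' i u)))),
               snd (snd u) + h *\<^sub>R (\<Sum>i=1..s. bq i *\<^sub>R snd (snd (f' i (Y' i u))))))) (at x)"
proof -
  have K: "((\<lambda>x. f (Y x j)) has_derivative (\<lambda>u. f' j (Y' j u))) (at x)" if "j \<in> {1..s}" for j
    using has_derivative_compose[OF Y' f'] that by blast
  have "((\<lambda>x. prk_update s bz bp bq h f x (Y x))
      has_derivative (\<lambda>u. (fst u + h *\<^sub>R (\<Sum>i=1..s. bz i *\<^sub>R fst (f' i (Y' i u))),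
               fst (snd u) + h *\<^sub>R (\<Sum>i=1..s. bp i *\<^sub>R fst (snd (f' i (Y' i u)))),
               snd (snd u) + h *\<^sub>R (\<Sum>i=1..s. bq i *\<^sub>R snd (snd (f' i (Y' i u))))))) (at x)"
    unfolding prk_update_def
    by (intro has_derivative_Pair has_derivative_add has_derivative_scaleR_right has_derivative_sum
        has_derivative_fst has_derivative_snd has_derivative_ident K)
  then show ?thesis
    using assms(1,2) by (rule has_derivative_transform_within_open) (use assms(3) in simp)
qed

lemma Ck_on_prk_update:
  fixes f :: "'z::real_inner \<times> 'p::real_inner \<times> 'q::real_inner \<Rightarrow> 'z \<times> 'p \<times> 'q"
  assumes U: "open U" and "open D" and "parseval_frame (E :: ('z \<times> 'p \<times> 'q) set)"
    and "\<And>x i. x \<in> U \<Longrightarrow> i \<in> {1..s} \<Longrightarrow> Y x i \<in> D"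
    and "\<And>i. i \<in> {1..s} \<Longrightarrow> Ck_on k U (\<lambda>x. Y x i)" and "Ck_on k D f"
  shows "Ck_on k U (\<lambda>x. prk_update s bz bp bq h f x (Y x))"
proof -
  have K: "Ck_on k U (\<lambda>x. f (Y x i))" if "i \<in> {1..s}" for i
    using assms(4)[OF _ that] by (intro Ck_on_compose[OF U assms(2,3) _ assms(5)[OF that] assms(6)]) auto
  have fst: "Ck_on k U (\<lambda>x. fst (g x))" if "Ck_on k U g"
    for g :: "'z \<times> 'p \<times> 'q \<Rightarrow> 'u::real_normed_vector \<times> 'v::real_normed_vector"
    using that by (rule Ck_on_bounded_linear[OF U bounded_linear_fst])
  have snd: "Ck_on k U (\<lambda>x. snd (g x))" if "Ck_on k U g"
    for g :: "'z \<times> 'p \<times> 'q \<Rightarrow> 'u::real_normed_vector \<times> 'v::real_normed_vector"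
    using that by (rule Ck_on_bounded_linear[OF U bounded_linear_snd])
  note sc = Ck_on_bounded_linear[OF U bounded_linear_scaleR_right]
  show ?thesis
    unfolding prk_update_def
    by (intro Ck_on_Pair Ck_on_add Ck_on_sum U sc)
       (auto intro!: fst snd K Ck_on_ident U)
qed

lemma bilinear_inner: "bilinear (\<bullet>)"
  by (auto simp: bilinear_def intro!: linearI simp: inner_add_left inner_add_right)

lemma bilinear_inner_mult_i: "bilinear (\<lambda>a b. a \<bullet> mult_i b)"
  unfolding bilinear_def
  by (intro conjI allI linearI) (simp_all add: linear_add[OF linear_mult_i] linear_scale[OF linear_mult_i]
      inner_add_left inner_add_right)

text \<open>The symplectic form is the sum of three pairings, namely of \<open>z\<close> with \<open>z\<close>, of \<open>q\<close> with \<open>p\<close> and of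
  \<open>p\<close> with \<open>q\<close>, and each is subject to \<open>rk_bilinear_increment\<close> with the coefficients of its two
  components. Since the weights coincide, the three increments at a stage combine to the full
  symplectic form, where they cancel.\<close>

lemma prk_update_symplectic:
  assumes B: "orthonormal_basis B"
    and rk: "symplectic_rk s az bz" and prk: "symplectic_prk s ap bp aq bq"
    and bb: "\<And>i. i \<in> {1..s} \<Longrightarrow> bz i = bp i \<and> bp i = bq i"
    and A: "\<And>i. i \<in> {1..s} \<Longrightarrow> A i = (fst u + h *\<^sub>R (\<Sum>j=1..s. az i j *\<^sub>R fst (K j)),
               fst (snd u) + h *\<^sub>R (\<Sum>j=1..s. ap i j *\<^sub>R fst (snd (K j))),
               snd (snd u) + h *\<^sub>R (\<Sum>j=1..s. aq i j *\<^sub>R snd (snd (K j))))"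
    and C: "\<And>i. i \<in> {1..s} \<Longrightarrow> C i = (fst v + h *\<^sub>R (\<Sum>j=1..s. az i j *\<^sub>R fst (L j)),
               fst (snd v) + h *\<^sub>R (\<Sum>j=1..s. ap i j *\<^sub>R fst (snd (L j))),
               snd (snd v) + h *\<^sub>R (\<Sum>j=1..s. aq i j *\<^sub>R snd (snd (L j))))"
    and skew: "\<And>i. i \<in> {1..s} \<Longrightarrow> omega_N B (A i) (L i) + omega_N B (K i) (C i) = 0"
  shows "omega_N B
      (fst u + h *\<^sub>R (\<Sum>i=1..s. bz i *\<^sub>R fst (K i)),
       fst (snd u) + h *\<^sub>R (\<Sum>i=1..s. bp i *\<^sub>R fst (snd (K i))),
       snd (snd u) + h *\<^sub>R (\<Sum>i=1..s. bq i *\<^sub>R snd (snd (K i))))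
      (fst v + h *\<^sub>R (\<Sum>i=1..s. bz i *\<^sub>R fst (L i)),
       fst (snd v) + h *\<^sub>R (\<Sum>i=1..s. bp i *\<^sub>R fst (snd (L i))),
       snd (snd v) + h *\<^sub>R (\<Sum>i=1..s. bq i *\<^sub>R snd (snd (L i))))
    = omega_N B u v" (is "omega_N B ?u ?v = _")
proof -
  note Az = arg_cong[where f = fst, OF A, unfolded fst_conv snd_conv]
  note Ap = arg_cong[where f = "\<lambda>x. fst (snd x)", OF A, unfolded fst_conv snd_conv]
  note Aq = arg_cong[where f = "\<lambda>x. snd (snd x)", OF A, unfolded fst_conv snd_conv]
  note Cz = arg_cong[where f = fst, OF C, unfolded fst_conv snd_conv]
  note Cp = arg_cong[where f = "\<lambda>x. fst (snd x)", OF C, unfolded fst_conv snd_conv]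
  note Cq = arg_cong[where f = "\<lambda>x. snd (snd x)", OF C, unfolded fst_conv snd_conv]
  have cz: "bz i * bz j = bz i * az i j + bz j * az j i" if "i \<in> {1..s}" "j \<in> {1..s}" for i j
    using rk that by (simp only: symplectic_rk_def)
  have cpq: "bp i * bq j = bp i * aq i j + bq j * ap j i" if "i \<in> {1..s}" "j \<in> {1..s}" for i j
    using prk that unfolding symplectic_prk_def by blast
  have cqp: "bq i * bp j = bq i * ap i j + bp j * aq j i" if "i \<in> {1..s}" "j \<in> {1..s}" for i j
    using cpq[OF that(2,1)] by (simp only: mult.commute[of "bq i"] add.commute)
  have z: "fst ?u \<bullet> mult_i (fst ?v) = fst u \<bullet> mult_i (fst v)
      + h * (\<Sum>i=1..s. bz i * (fst (A i) \<bullet> mult_i (fst (L i))) + bz i * (fst (K i) \<bullet> mult_i (fst (C i))))"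
    unfolding fst_conv snd_conv by (rule rk_bilinear_increment[OF bilinear_inner_mult_i cz Az Cz])
  have qp: "snd (snd ?u) \<bullet> fst (snd ?v) = snd (snd u) \<bullet> fst (snd v)
      + h * (\<Sum>i=1..s. bp i * (snd (snd (A i)) \<bullet> fst (snd (L i))) + bq i * (snd (snd (K i)) \<bullet> fst (snd (C i))))"
    unfolding fst_conv snd_conv by (rule rk_bilinear_increment[OF bilinear_inner cqp Aq Cp])
  have pq: "fst (snd ?u) \<bullet> snd (snd ?v) = fst (snd u) \<bullet> snd (snd v)
      + h * (\<Sum>i=1..s. bq i * (fst (snd (A i)) \<bullet> snd (snd (L i))) + bp i * (fst (snd (K i)) \<bullet> snd (snd (C i))))"
    unfolding fst_conv snd_conv by (rule rk_bilinear_increment[OF bilinear_inner cpq Ap Cq])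
  have "omega_N B ?u ?v = omega_N B u v
      + h * (\<Sum>i=1..s. bq i * (omega_N B (A i) (L i) + omega_N B (K i) (C i)))"
    unfolding omega_N_split[OF B] z qp pq
    by (simp add: bb sum_subtractf sum.distrib algebra_simps)
  then show ?thesis using skew by simp
qed

section \<open>The map \<open>J\<close>\<close>

text \<open>A bilinear (not symmetric) form whose quadratic form is \<open>J\<close>; up to scaling \<open>J\<close> is the Hopf
  map. Symmetrizing gives the derivative \<open>DJ\<close> of \<open>J\<close>.\<close>

definition J_form :: "complex \<Rightarrow> complex \<Rightarrow> complex \<Rightarrow> complex \<Rightarrow> real ^ 3" where
  "J_form z1 z2 u1 u2 = (1 / 4) *\<^sub>R
     vector [2 * Re (z1 * cnj u2), 2 * Im (z1 * cnj u2), z1 \<bullet> u1 - z2 \<bullet> u2]"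

definition DJ :: "complex \<Rightarrow> complex \<Rightarrow> complex \<Rightarrow> complex \<Rightarrow> real ^ 3" where
  "DJ z1 z2 u1 u2 = J_form z1 z2 u1 u2 + J_form u1 u2 z1 z2"

lemma J_eq_form: "J z1 z2 = J_form z1 z2 z1 z2"
  by (simp add: J_def J_form_def dot_square_norm)

lemma J_form_nth:
  "J_form z1 z2 u1 u2 $ 1 = (Re z1 * Re u2 + Im z1 * Im u2) / 2"
  "J_form z1 z2 u1 u2 $ 2 = (Im z1 * Re u2 - Re z1 * Im u2) / 2"
  "J_form z1 z2 u1 u2 $ 3 = (Re z1 * Re u1 + Im z1 * Im u1 - Re z2 * Re u2 - Im z2 * Im u2) / 4"
  by (simp_all add: J_form_def inner_complex_def field_simps)

lemma J_nth:
  "J z1 z2 $ 1 = (Re z1 * Re z2 + Im z1 * Im z2) / 2"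
  "J z1 z2 $ 2 = (Im z1 * Re z2 - Re z1 * Im z2) / 2"
  "J z1 z2 $ 3 = ((Re z1)\<^sup>2 + (Im z1)\<^sup>2 - (Re z2)\<^sup>2 - (Im z2)\<^sup>2) / 4"
  by (simp_all add: J_eq_form J_form_nth power2_eq_square)

lemma DJ_nth:
  "DJ z1 z2 u1 u2 $ 1 = (Re z1 * Re u2 + Im z1 * Im u2 + Re u1 * Re z2 + Im u1 * Im z2) / 2"
  "DJ z1 z2 u1 u2 $ 2 = (Im z1 * Re u2 - Re z1 * Im u2 + Im u1 * Re z2 - Re u1 * Im z2) / 2"
  "DJ z1 z2 u1 u2 $ 3 = (Re z1 * Re u1 + Im z1 * Im u1 - Re z2 * Re u2 - Im z2 * Im u2) / 2"
  by (simp_all add: DJ_def J_form_nth field_simps)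

lemma inner_cross3: "(w :: real ^ 3) \<bullet> cross3 a b =
   w $ 1 * (a $ 2 * b $ 3 - a $ 3 * b $ 2) + w $ 2 * (a $ 3 * b $ 1 - a $ 1 * b $ 3)
   + w $ 3 * (a $ 1 * b $ 2 - a $ 2 * b $ 1)"
  by (simp add: cross3_def inner_vec_def sum_3)

lemma inner_3: "(a :: real ^ 3) \<bullet> b = a $ 1 * b $ 1 + a $ 2 * b $ 2 + a $ 3 * b $ 3"
  by (simp add: inner_vec_def sum_3)

lemma norm_J: "norm (J z1 z2) = ((cmod z1)\<^sup>2 + (cmod z2)\<^sup>2) / 4"
proof -
  have "J z1 z2 \<bullet> J z1 z2 = (((cmod z1)\<^sup>2 + (cmod z2)\<^sup>2) / 4)\<^sup>2"
    unfolding cmod_power2 inner_3 J_nth by (simp add: field_simps power2_eq_square)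
  then show ?thesis by (simp add: norm_eq_sqrt_inner)
qed

lemma J_eq_0_iff: "J z1 z2 = 0 \<longleftrightarrow> z1 = 0 \<and> z2 = 0"
proof -
  have "J z1 z2 = 0 \<longleftrightarrow> (cmod z1)\<^sup>2 + (cmod z2)\<^sup>2 = 0"
    using norm_J[of z1 z2] by (metis divide_eq_0_iff norm_eq_zero zero_neq_numeral)
  then show ?thesis by (simp add: add_nonneg_eq_0_iff)
qed

text \<open>\<open>J\<close> is a Poisson map; the arguments \<open>a\<close> and \<open>b\<close> are the gradients of the two functions on
  \<open>\<real>\<^sup>3\<close>.\<close>

lemma J_bracket:
  "(a \<bullet> DJ z1 z2 \<i> 0) * (b \<bullet> DJ z1 z2 1 0) - (a \<bullet> DJ z1 z2 1 0) * (b \<bullet> DJ z1 z2 \<i> 0)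
   + ((a \<bullet> DJ z1 z2 0 \<i>) * (b \<bullet> DJ z1 z2 0 1) - (a \<bullet> DJ z1 z2 0 1) * (b \<bullet> DJ z1 z2 0 \<i>))
   = J z1 z2 \<bullet> cross3 a b"
  unfolding inner_cross3 unfolding inner_3 J_nth DJ_nth
  by (simp add: field_simps power2_eq_square)

lemma DJ_zero: "DJ z1 z2 0 0 = 0"
  by (simp add: vec_eq_iff forall_3 DJ_nth)

text \<open>\<open>J\<close> is invariant under a common phase, and \<open>(\<i> z1, \<i> z2)\<close> is the direction of the orbit.\<close>

lemma DJ_rotation: "DJ z1 z2 (\<i> * z1) (\<i> * z2) = 0"
  by (simp add: vec_eq_iff forall_3 DJ_nth)

lemma J_inner_DJ: "J z1 z2 \<bullet> DJ z1 z2 u1 u2 = norm (J z1 z2) / 2 * (z1 \<bullet> u1 + z2 \<bullet> u2)"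
  unfolding norm_J inner_3 J_nth DJ_nth cmod_power2 inner_complex_def
  by (simp add: field_simps power2_eq_square)

text \<open>On vectors orthogonal to the orbit direction \<open>(\<i> z1, \<i> z2)\<close>, the vector product with \<open>J\<close>, which is
  up to scaling the complex structure of the sphere, corresponds to the multiplication with \<open>- \<i>\<close>
  upstairs. The next lemma expresses that \<open>J\<close> is a conformal submersion. Together they compute the
  area form of the sphere upstairs.\<close>

lemma J_cross_DJ:
  "cross3 (J z1 z2) (DJ z1 z2 u1 u2) = - (norm (J z1 z2) *\<^sub>R DJ z1 z2 (\<i> * u1) (\<i> * u2))
     - (((\<i> * z1) \<bullet> u1 + (\<i> * z2) \<bullet> u2) / 2) *\<^sub>R J z1 z2"
  unfolding vec_eq_iff forall_3 norm_J cmod_power2 inner_complex_def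
  by (simp add: cross3_def DJ_nth J_nth field_simps power2_eq_square)

lemma DJ_inner_DJ:
  "DJ z1 z2 u1 u2 \<bullet> DJ z1 z2 v1 v2 = norm (J z1 z2) * (u1 \<bullet> v1 + u2 \<bullet> v2)
     - ((\<i> * z1) \<bullet> u1 + (\<i> * z2) \<bullet> u2) * ((\<i> * z1) \<bullet> v1 + (\<i> * z2) \<bullet> v2) / 4"
  unfolding inner_3 DJ_nth norm_J cmod_power2 inner_complex_def
  by (simp add: field_simps power2_eq_square)

text \<open>Symplectic reduction on one sphere. On vectors tangent to a level set of
  \<open>|z1|\<^sup>2 + |z2|\<^sup>2\<close> the area form pulls back to the symplectic form, up to the factor
  \<open>(norm (J z1 z2))\<^sup>2\<close> that is \<open>1\<close> over the unit sphere.\<close>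

lemma J_reduction:
  assumes "z1 \<bullet> u1 + z2 \<bullet> u2 = 0" and "z1 \<bullet> v1 + z2 \<bullet> v2 = 0"
  shows "J z1 z2 \<bullet> cross3 (DJ z1 z2 u1 u2) (DJ z1 z2 v1 v2)
    = (norm (J z1 z2))\<^sup>2 * ((Im u1 * Re v1 - Re u1 * Im v1) + (Im u2 * Re v2 - Re u2 * Im v2))"
proof -
  have "(\<i> * z1) \<bullet> (\<i> * u1) + (\<i> * z2) \<bullet> (\<i> * u2) = 0"
    using assms(1) by (simp add: inner_complex_def algebra_simps)
  then have "DJ z1 z2 (\<i> * u1) (\<i> * u2) \<bullet> DJ z1 z2 v1 v2
      = - (norm (J z1 z2) * ((Im u1 * Re v1 - Re u1 * Im v1) + (Im u2 * Re v2 - Re u2 * Im v2)))"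
    unfolding DJ_inner_DJ by (simp add: inner_complex_def algebra_simps)
  moreover have "J z1 z2 \<bullet> DJ z1 z2 v1 v2 = 0"
    using assms(2) by (simp add: J_inner_DJ)
  moreover have "J z1 z2 \<bullet> cross3 (DJ z1 z2 u1 u2) (DJ z1 z2 v1 v2)
      = cross3 (J z1 z2) (DJ z1 z2 u1 u2) \<bullet> DJ z1 z2 v1 v2"
    by (simp add: cross3_def inner_3 algebra_simps)
  ultimately show ?thesis
    by (simp add: J_cross_DJ inner_diff_left power2_eq_square)
qed

lemma DJ_surj:
  assumes "J z1 z2 \<noteq> 0"
  shows "\<exists>u1 u2. DJ z1 z2 u1 u2 = w"
proof -
  define \<rho> where "\<rho> = (Re z1)\<^sup>2 + (Im z1)\<^sup>2 + ((Re z2)\<^sup>2 + (Im z2)\<^sup>2)"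
  have "\<rho> \<noteq> 0"
    using assms unfolding J_eq_0_iff \<rho>_def
    by (simp add: add_nonneg_eq_0_iff complex_eq_iff)
  \<comment> \<open>The gradients of the three components of \<open>J\<close> are orthogonal and of equal length, so a
    preimage of \<open>w\<close> is a multiple of their combination with coefficients \<open>w\<close>.\<close>
  define u1 where "u1 = Complex (w $ 1 * Re z2 - w $ 2 * Im z2 + w $ 3 * Re z1)
                                (w $ 1 * Im z2 + w $ 2 * Re z2 + w $ 3 * Im z1)"
  define u2 where "u2 = Complex (w $ 1 * Re z1 + w $ 2 * Im z1 - w $ 3 * Re z2)
                                (w $ 1 * Im z1 - w $ 2 * Re z1 - w $ 3 * Im z2)"
  have "DJ z1 z2 u1 u2 = (\<rho> / 2) *\<^sub>R w"
    unfolding vec_eq_iff forall_3 \<rho>_def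
    by (simp add: DJ_nth u1_def u2_def field_simps power2_eq_square)
  moreover have "DJ z1 z2 (c *\<^sub>R u1) (c *\<^sub>R u2) = c *\<^sub>R DJ z1 z2 u1 u2" for c
    by (simp add: vec_eq_iff forall_3 DJ_nth algebra_simps)
  ultimately have "DJ z1 z2 ((2 / \<rho>) *\<^sub>R u1) ((2 / \<rho>) *\<^sub>R u2) = w"
    using \<open>\<rho> \<noteq> 0\<close> by simp
  then show ?thesis by blast
qed

lemma J_rotate: "cmod l = 1 \<Longrightarrow> J (l * z1) (l * z2) = J z1 z2"
proof -
  assume l: "cmod l = 1"
  have "l * z1 * cnj (l * z2) = (l * cnj l) * (z1 * cnj z2)" by simp
  also have "\<dots> = z1 * cnj z2" using l by (simp add: complex_norm_square[symmetric])
  finally show ?thesis using l by (simp only: J_def norm_mult mult_1)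
qed

lemma J_fst: "(cmod z1)\<^sup>2 = 2 * (norm (J z1 z2) + J z1 z2 $ 3)"
  and J_snd: "(cmod z2)\<^sup>2 = 2 * (norm (J z1 z2) - J z1 z2 $ 3)"
  and J_prod: "z1 * cnj z2 = 2 * Complex (J z1 z2 $ 1) (J z1 z2 $ 2)"
  by (simp_all add: norm_J J_nth cmod_power2 complex_eq_iff field_simps)

text \<open>The moduli of \<open>z1\<close>, \<open>z2\<close> and the product \<open>z1 * cnj z2\<close> are functions of \<open>J z1 z2\<close>, and these
  determine the pair up to a common phase.\<close>

lemma J_fibre:
  assumes "J z1 z2 = J y1 y2"
  shows "\<exists>l. cmod l = 1 \<and> y1 = l * z1 \<and> y2 = l * z2"
proof -
  have n1: "cmod y1 = cmod z1" and n2: "cmod y2 = cmod z2"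
    using J_fst[of y1 y2] J_fst[of z1 z2] J_snd[of y2 y1] J_snd[of z2 z1] assms
    by (metis norm_ge_zero power2_eq_imp_eq)+
  have p: "y1 * cnj y2 = z1 * cnj z2" using J_prod[of y1 y2] J_prod[of z1 z2] assms by metis
  consider "z1 \<noteq> 0" | "z1 = 0" "z2 \<noteq> 0" | "z1 = 0" "z2 = 0" by blast
  then show ?thesis
  proof cases
    case 1
    define l where "l = y1 / z1"
    have l: "cmod l = 1" using 1 n1 by (simp add: l_def norm_divide)
    then have ll: "l * cnj l = 1" by (simp add: complex_norm_square[symmetric])
    have y1: "y1 = l * z1" using 1 by (simp add: l_def)
    have "z1 * (l * cnj y2) = z1 * cnj z2" using p y1 by (simp add: ac_simps)
    then have "l * cnj y2 = cnj z2" using 1 by simp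
    then have "cnj l * y2 = z2" by (metis complex_cnj_cnj complex_cnj_mult)
    then have "y2 = l * z2" using ll by (metis mult.assoc mult_1)
    then show ?thesis using l y1 by blast
  next
    case 2
    then have "y1 = 0" using n1 by simp
    then show ?thesis
      using 2 n2 by (intro exI[of _ "y2 / z2"]) (simp add: norm_divide)
  next
    case 3
    then show ?thesis using n1 n2 by (intro exI[of _ 1]) simp
  qed
qed

text \<open>On the set where \<open>norm w + w $ 3\<close> is positive, the first coordinate of a preimage has the modulus
  \<open>\<rho> w\<close> by \<open>J_fst\<close>. Fixing its phase to be that of \<open>z1\<close> determines the second coordinate through
  \<open>J_prod\<close>, and makes the section pass through the given point.\<close>

lemma J_local_section_1:
  assumes "z1 \<noteq> 0"
  shows "\<exists>W \<sigma>. open W \<and> J z1 z2 \<in> W \<and> (\<forall>k. Ck_on k W \<sigma>) \<and>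
     (\<forall>w\<in>W. J (fst (\<sigma> w)) (snd (\<sigma> w)) = w) \<and> \<sigma> (J z1 z2) = (z1, z2)"
proof -
  define l where "l = z1 / of_real (cmod z1)"
  have l: "cmod l = 1" using assms by (simp add: l_def norm_divide)
  define W where "W = {w :: real ^ 3. 0 < norm w + w $ 3}"
  define \<rho> where "\<rho> w = sqrt (2 * (sqrt (w \<bullet> w) + w $ 3))" for w :: "real ^ 3"
  define \<sigma> where "\<sigma> w = (\<rho> w *\<^sub>R l, inverse (\<rho> w) *\<^sub>R (l * (2 * Complex (w $ 1) (- (w $ 2)))))" for w
  have "open W" unfolding W_def by (intro open_Collect_less continuous_intros)
  have pos: "0 < w \<bullet> w" if "w \<in> W" for w using that by (auto simp: W_def)
  have \<rho>_pos: "0 < \<rho> w" and \<rho>2: "(\<rho> w)\<^sup>2 = 2 * (norm w + w $ 3)" if "w \<in> W" for w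
    using that by (auto simp: W_def \<rho>_def norm_eq_sqrt_inner)
  have nm: "Ck_on k W (\<lambda>w. sqrt (w \<bullet> w))" for k
    using pos
    by (intro Ck_on_compose[where B = Basis, OF \<open>open W\<close> _ parseval_frame_Basis _ _ Ck_on_sqrt]
        Ck_on_bilinear[OF \<open>open W\<close> bounded_bilinear_inner] Ck_on_ident \<open>open W\<close>) auto
  have "Ck_on k W (\<lambda>w. 2 * (sqrt (w \<bullet> w) + w $ 3))" for k
    by (intro Ck_on_bounded_linear[OF \<open>open W\<close> bounded_linear_mult_right] Ck_on_add nm \<open>open W\<close>
        Ck_on_bounded_linear[OF \<open>open W\<close> bounded_linear_vec_nth] Ck_on_ident)
  then have \<rho>: "Ck_on k W \<rho>" for k
    unfolding \<rho>_def
    by (intro Ck_on_compose[where B = Basis, OF \<open>open W\<close> _ parseval_frame_Basis _ _ Ck_on_sqrt])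
       (auto simp: W_def norm_eq_sqrt_inner)
  have inv: "Ck_on k W (\<lambda>w. inverse (\<rho> w))" for k
    using \<rho>_pos
    by (intro Ck_on_compose[where B = Basis, OF \<open>open W\<close> _ parseval_frame_Basis _ \<rho> Ck_on_inverse_real]) fastforce+
  have "linear (\<lambda>w. l * (2 * Complex (w $ 1) (- (w $ 2))))"
    by (rule linearI) (simp_all add: complex_eq_iff algebra_simps)
  then have lin: "Ck_on k W (\<lambda>w. l * (2 * Complex (w $ 1) (- (w $ 2))))" for k
    by (intro Ck_on_bounded_linear[OF \<open>open W\<close> _ Ck_on_ident[OF \<open>open W\<close>]]) (simp add: linear_conv_bounded_linear)
  have \<sigma>: "Ck_on k W \<sigma>" for k
    unfolding \<sigma>_def
    by (intro Ck_on_Pair \<open>open W\<close> Ck_on_bounded_linear[OF \<open>open W\<close> bounded_linear_scaleR_left] \<rho>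
        Ck_on_bilinear[OF _ bounded_bilinear_scaleR] inv lin)
  have sec: "J (fst (\<sigma> w)) (snd (\<sigma> w)) = w" if "w \<in> W" for w
  proof -
    have "J (fst (\<sigma> w)) (snd (\<sigma> w)) = J (l * of_real (\<rho> w)) (l * (inverse (\<rho> w) *\<^sub>R (2 * Complex (w $ 1) (- (w $ 2)))))"
      by (simp add: \<sigma>_def scaleR_conv_of_real ac_simps)
    also have "\<dots> = J (of_real (\<rho> w)) (inverse (\<rho> w) *\<^sub>R (2 * Complex (w $ 1) (- (w $ 2))))"
      by (rule J_rotate[OF l])
    also have "\<dots> = w"
    proof -
      have nw: "(norm w)\<^sup>2 = (w $ 1)\<^sup>2 + (w $ 2)\<^sup>2 + (w $ 3)\<^sup>2"
        unfolding power2_norm_eq_inner inner_3 by (simp add: power2_eq_square)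
      have "4 * (w $ 1)\<^sup>2 + 4 * (w $ 2)\<^sup>2 = (\<rho> w)\<^sup>2 * ((\<rho> w)\<^sup>2 - 4 * w $ 3)"
        unfolding \<rho>2[OF that] using nw by (simp add: algebra_simps power2_eq_square)
      then have "(\<rho> w)\<^sup>2 - (inverse (\<rho> w))\<^sup>2 * (4 * (w $ 1)\<^sup>2 + 4 * (w $ 2)\<^sup>2) = 4 * w $ 3"
        using \<rho>_pos[OF that] by (simp add: field_simps power2_eq_square)
      then show ?thesis
        using \<rho>_pos[OF that]
        by (simp add: vec_eq_iff forall_3 J_nth power_mult_distrib algebra_simps)
    qed
    finally show ?thesis .
  qed
  have inW: "J z1 z2 \<in> W"
  proof -
    have "0 < (cmod z1)\<^sup>2" using assms by simp
    then show ?thesis using J_fst[of z1 z2] by (simp add: W_def)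
  qed
  have rz: "\<rho> (J z1 z2) = cmod z1"
    unfolding \<rho>_def norm_eq_sqrt_inner[symmetric] J_fst[symmetric] by simp
  have "\<sigma> (J z1 z2) = (z1, z2)"
  proof -
    have "2 * Complex (J z1 z2 $ 1) (- (J z1 z2 $ 2)) = cnj z1 * z2"
      using arg_cong[OF J_prod[of z1 z2], of cnj] by (simp add: complex_eq_iff)
    moreover have "of_real (inverse (cmod z1)) * (z1 / of_real (cmod z1) * (cnj z1 * z2)) = z2"
      using assms complex_norm_square[of z1] by (simp add: field_simps power2_eq_square)
    ultimately show ?thesis
      using assms by (simp add: \<sigma>_def rz l_def scaleR_conv_of_real)
  qed
  then show ?thesis using \<open>open W\<close> inW \<sigma> sec by blast
qed

text \<open>Where \<open>z1\<close> vanishes, the section is obtained by exchanging the two coordinates, which acts on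
  \<open>\<real>\<^sup>3\<close> as the half turn \<open>T\<close> about the first axis.\<close>

lemma J_local_section:
  assumes "J z1 z2 \<noteq> 0"
  shows "\<exists>W \<sigma>. open W \<and> J z1 z2 \<in> W \<and> (\<forall>k. Ck_on k W \<sigma>) \<and>
     (\<forall>w\<in>W. J (fst (\<sigma> w)) (snd (\<sigma> w)) = w) \<and> \<sigma> (J z1 z2) = (z1, z2)"
proof (cases "z1 = 0")
  case False
  then show ?thesis by (rule J_local_section_1)
next
  case True
  then have "z2 \<noteq> 0" using assms by (simp add: J_eq_0_iff)
  from J_local_section_1[OF this, of z1] obtain W \<sigma> where W: "open W" "J z2 z1 \<in> W"
    and \<sigma>: "\<And>k. Ck_on k W \<sigma>" and sec: "\<And>w. w \<in> W \<Longrightarrow> J (fst (\<sigma> w)) (snd (\<sigma> w)) = w"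
    and base: "\<sigma> (J z2 z1) = (z2, z1)" by blast
  define T :: "real ^ 3 \<Rightarrow> real ^ 3" where "T w = vector [w $ 1, - (w $ 2), - (w $ 3)]" for w
  have T: "T (J y1 y2) = J y2 y1" for y1 y2
    by (simp add: T_def vec_eq_iff forall_3 J_nth field_simps)
  have TT: "T (T w) = w" for w by (simp add: T_def vec_eq_iff forall_3)
  have "linear T" by (rule linearI) (simp_all add: T_def vec_eq_iff forall_3)
  then have bT: "bounded_linear T" by (simp add: linear_conv_bounded_linear)
  have oV: "open (T -` W)"
    using W(1) bT by (intro open_vimage linear_continuous_on) auto
  have C1: "Ck_on k (T -` W) (\<lambda>w. \<sigma> (T w))" for k
    by (rule Ck_on_compose[where B = Basis, OF oV W(1) parseval_frame_Basis _
        Ck_on_bounded_linear[OF oV bT Ck_on_ident[OF oV]] \<sigma>]) auto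
  have "Ck_on k (T -` W) (\<lambda>w. (snd (\<sigma> (T w)), fst (\<sigma> (T w))))" for k
    by (intro Ck_on_Pair oV Ck_on_bounded_linear[OF oV bounded_linear_snd C1]
        Ck_on_bounded_linear[OF oV bounded_linear_fst C1])
  moreover have "J (snd (\<sigma> (T w))) (fst (\<sigma> (T w))) = w" if "w \<in> T -` W" for w
    using that sec[of "T w"] T TT by (metis vimageD)
  ultimately show ?thesis
    using oV W(2) base
    by (intro exI[of _ "T -` W"] exI[of _ "\<lambda>w. (snd (\<sigma> (T w)), fst (\<sigma> (T w)))"]) (auto simp: T)
qed

section \<open>The map \<open>psi\<close>\<close>

definition psi_form :: "(complex ^ 'n::finite) \<times> (complex ^ 'n) \<Rightarrow> (complex ^ 'n) \<times> (complex ^ 'n) \<Rightarrow> real ^ 3 ^ 'n" where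
  "psi_form z u = (\<chi> j. J_form (fst z $ j) (snd z $ j) (fst u $ j) (snd u $ j))"

definition Dpsi :: "('n::finite, 'e::real_inner) N \<Rightarrow> ('n, 'e) N \<Rightarrow> ('n, 'e) P" where
  "Dpsi x v = ((\<chi> j. DJ (fst (fst x) $ j) (snd (fst x) $ j) (fst (fst v) $ j) (snd (fst v) $ j)), snd v)"

lemma psi_eq: "psi x = ((\<chi> j. J (fst (fst x) $ j) (snd (fst x) $ j)), snd x)"
  by (simp add: psi_def split: prod.split)

lemma bounded_bilinear_psi_form: "bounded_bilinear psi_form"
  unfolding bilinear_conv_bounded_bilinear[symmetric] bilinear_def
  by (intro conjI allI linearI)
     (simp_all add: psi_form_def vec_eq_iff forall_3 J_form_nth field_simps)

lemma psi_eq_form: "psi x = (psi_form (fst x) (fst x), snd x)"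
  by (simp add: psi_eq psi_form_def J_eq_form)

lemma psi_has_derivative: "(psi has_derivative Dpsi x) (at x)"
proof -
  have "((\<lambda>x. (psi_form (fst x) (fst x), snd x)) has_derivative
      (\<lambda>v. (psi_form (fst x) (fst v) + psi_form (fst v) (fst x), snd v))) (at x)"
    by (intro has_derivative_Pair bounded_bilinear.FDERIV[OF bounded_bilinear_psi_form]
        has_derivative_fst has_derivative_snd has_derivative_ident)
  moreover have "(\<lambda>v. (psi_form (fst x) (fst v) + psi_form (fst v) (fst x), snd v)) = Dpsi x"
    by (simp add: fun_eq_iff Dpsi_def psi_form_def DJ_def vec_eq_iff)
  ultimately show ?thesis by (simp add: psi_eq_form[abs_def])
qed

lemma Ck_on_psi: "open S \<Longrightarrow> Ck_on k S psi"
  unfolding psi_eq_form[abs_def]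
  by (intro Ck_on_Pair Ck_on_bilinear[OF _ bounded_bilinear_psi_form]
      Ck_on_bounded_linear[OF _ bounded_linear_fst] Ck_on_bounded_linear[OF _ bounded_linear_snd]
      Ck_on_ident)

lemma continuous_on_psi: "continuous_on UNIV psi"
  using Ck_on_psi[of UNIV 0] by simp

text \<open>Sections of \<open>J\<close> for every \<open>w\<^sub>j\<close>, together with the identity on \<open>(p, q)\<close>. That the section passes
  through the prescribed point is essential later: the method is defined near that point
  only.\<close>

lemma psi_local_section:
  fixes x\<^sub>0 :: "('n::finite, 'e::real_inner) N"
  assumes "psi x\<^sub>0 \<in> P_star"
  shows "\<exists>W \<sigma>. open W \<and> psi x\<^sub>0 \<in> W \<and> (\<forall>k. Ck_on k W \<sigma>) \<and> (\<forall>y\<in>W. psi (\<sigma> y) = y) \<and> \<sigma> (psi x\<^sub>0) = x\<^sub>0"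
proof -
  define z1 z2 where "z1 = fst (fst x\<^sub>0)" and "z2 = snd (fst x\<^sub>0)"
  have "J (z1 $ j) (z2 $ j) \<noteq> 0" for j
    using assms by (simp add: psi_eq P_star_def z1_def z2_def)
  then have "\<forall>j. \<exists>W \<sigma>. open W \<and> J (z1 $ j) (z2 $ j) \<in> W \<and> (\<forall>k. Ck_on k W \<sigma>) \<and>
     (\<forall>w\<in>W. J (fst (\<sigma> w)) (snd (\<sigma> w)) = w) \<and> \<sigma> (J (z1 $ j) (z2 $ j)) = (z1 $ j, z2 $ j)"
    using J_local_section by blast
  then obtain W s where W: "\<And>j. open (W j)" "\<And>j. J (z1 $ j) (z2 $ j) \<in> W j"
    and s: "\<And>j k. Ck_on k (W j) (s j)" and sec: "\<And>j w. w \<in> W j \<Longrightarrow> J (fst (s j w)) (snd (s j w)) = w"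
    and base: "\<And>j. s j (J (z1 $ j) (z2 $ j)) = (z1 $ j, z2 $ j)" by metis
  define V :: "('n, 'e) P set" where "V = (\<Inter>j. (\<lambda>y. fst y $ j) -` W j)"
  define \<sigma> :: "('n, 'e) P \<Rightarrow> ('n, 'e) N"
    where "\<sigma> y = (((\<chi> j. fst (s j (fst y $ j))), (\<chi> j. snd (s j (fst y $ j)))), snd y)" for y
  have bl: "bounded_linear (\<lambda>y :: ('n, 'e) P. fst y $ j)" for j
    using bounded_linear_compose[OF bounded_linear_vec_nth bounded_linear_fst] .
  have oV: "open V"
    unfolding V_def by (intro open_INT ballI open_vimage linear_continuous_on W(1) bl) simp
  have sj: "Ck_on k V (\<lambda>y. s j (fst y $ j))" for k j
    by (rule Ck_on_compose[where B = Basis, OF oV W(1)[of j] parseval_frame_Basis _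
        Ck_on_bounded_linear[OF oV bl Ck_on_ident[OF oV]] s]) (auto simp: V_def)
  have "Ck_on k V \<sigma>" for k
    unfolding \<sigma>_def
    by (intro Ck_on_Pair Ck_on_vec_lambda oV Ck_on_bounded_linear[OF oV bounded_linear_fst sj]
        Ck_on_bounded_linear[OF oV bounded_linear_snd sj]
        Ck_on_bounded_linear[OF oV bounded_linear_snd Ck_on_ident[OF oV]])
  moreover have "psi (\<sigma> y) = y" if "y \<in> V" for y
    using that sec by (simp add: psi_eq \<sigma>_def V_def prod_eq_iff vec_eq_iff)
  moreover have "psi x\<^sub>0 \<in> V" using W(2) by (simp add: V_def psi_eq z1_def z2_def)
  moreover have "\<sigma> (psi x\<^sub>0) = x\<^sub>0"
    using base by (simp add: \<sigma>_def psi_eq prod_eq_iff vec_eq_iff z1_def z2_def)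
  ultimately show ?thesis using oV by blast
qed

lemma grad_w_inner:
  assumes "f differentiable (at y)"
  shows "frechet_derivative f (at y) (axis j w, 0, 0) = grad_w f j y \<bullet> w"
proof -
  have l: "linear (frechet_derivative f (at y))" using assms by (rule linear_frechet_derivative)
  have "axis j w = (\<Sum>i\<in>UNIV. (w $ i) *\<^sub>R axis j (axis i 1))"
    by (simp add: vec_eq_iff axis_def if_distrib[of "\<lambda>x. _ * x"] cong: if_cong)
  then have "(axis j w, 0, 0) = (\<Sum>i\<in>UNIV. (w $ i) *\<^sub>R (axis j (axis i 1), 0 :: 'b, 0 :: 'b))"
    by (simp add: prod_eq_iff fst_sum snd_sum)
  then show ?thesis
    by (simp only: linear_sum[OF l] linear_scale[OF l])
       (simp add: grad_w_def inner_vec_def mult.commute)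
qed

text \<open>For every \<open>w\<^sub>j\<close> this is \<open>J_bracket\<close>, and on \<open>(p, q)\<close> the map is the
  identity.\<close>

lemma psi_poisson:
  assumes f: "f differentiable (at (psi x))" and g: "g differentiable (at (psi x))"
  shows "bracket_N B (f \<circ> psi) (g \<circ> psi) x = bracket_P B f g (psi x)"
proof -
  have psi_d: "psi differentiable (at x)" and psi_fd: "frechet_derivative psi (at x) = Dpsi x"
    using psi_has_derivative[of x] frechet_derivative_at[OF psi_has_derivative, of x]
    by (auto simp: differentiable_def)
  have df: "frechet_derivative (f \<circ> psi) (at x) v = frechet_derivative f (at (psi x)) (Dpsi x v)" for v
    using frechet_derivative_compose[OF psi_d f] psi_fd by simp
  have dg: "frechet_derivative (g \<circ> psi) (at x) v = frechet_derivative g (at (psi x)) (Dpsi x v)" for v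
    using frechet_derivative_compose[OF psi_d g] psi_fd by simp
  have d1: "Dpsi x ((axis j c, 0), 0, 0) = (axis j (DJ (fst (fst x) $ j) (snd (fst x) $ j) c 0), 0, 0)" for j c
    by (auto simp: Dpsi_def vec_eq_iff axis_def DJ_zero)
  have d2: "Dpsi x ((0, axis j c), 0, 0) = (axis j (DJ (fst (fst x) $ j) (snd (fst x) $ j) 0 c), 0, 0)" for j c
    by (auto simp: Dpsi_def vec_eq_iff axis_def DJ_zero)
  have d3: "Dpsi x (0, p, q) = (0, p, q)" for p q
    by (simp add: Dpsi_def vec_eq_iff DJ_zero)
  have fst_psi: "fst (psi x) $ j = J (fst (fst x) $ j) (snd (fst x) $ j)" for j
    by (simp add: psi_eq)
  show ?thesis
    unfolding bracket_N_def bracket_P_def Let_def df dg d1 d2 d3 grad_w_inner[OF f] grad_w_inner[OF g]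
      fst_psi J_bracket[symmetric] sum.distrib
    by simp
qed

section \<open>The torus action\<close>

definition rotate_z :: "('n::finite \<Rightarrow> complex) \<Rightarrow> (complex ^ 'n) \<times> (complex ^ 'n) \<Rightarrow> (complex ^ 'n) \<times> (complex ^ 'n)" where
  "rotate_z l z = ((\<chi> j. l j * fst z $ j), (\<chi> j. l j * snd z $ j))"

definition rotate_N :: "('n::finite \<Rightarrow> complex) \<Rightarrow> ('n, 'e::real_inner) N \<Rightarrow> ('n, 'e) N" where
  "rotate_N l x = (rotate_z l (fst x), snd x)"

lemma linear_rotate_z: "linear (rotate_z l)"
  by (rule linearI) (simp_all add: rotate_z_def vec_eq_iff algebra_simps)

lemma linear_rotate_N: "linear (rotate_N l)"
  by (rule linearI) (simp_all add: rotate_N_def linear_add[OF linear_rotate_z] linear_scale[OF linear_rotate_z])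

lemma psi_rotate_N: "(\<And>j. cmod (l j) = 1) \<Longrightarrow> psi (rotate_N l x) = psi x"
  by (simp add: psi_eq rotate_N_def rotate_z_def J_rotate)

text \<open>The fibres of \<open>psi\<close> are the orbits of the torus that acts by one phase for each sphere.\<close>

lemma psi_fibre:
  assumes "psi x = psi y"
  shows "\<exists>l. (\<forall>j. cmod (l j) = 1) \<and> y = rotate_N l x"
proof -
  have "\<exists>l. cmod l = 1 \<and> fst (fst y) $ j = l * fst (fst x) $ j \<and> snd (fst y) $ j = l * snd (fst x) $ j" for j
    using assms by (intro J_fibre) (simp add: psi_eq vec_eq_iff)
  then obtain l where "\<And>j. cmod (l j) = 1 \<and> fst (fst y) $ j = l j * fst (fst x) $ j \<and>
      snd (fst y) $ j = l j * snd (fst x) $ j" by metis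
  then show ?thesis
    using assms by (intro exI[of _ l]) (simp add: psi_eq rotate_N_def rotate_z_def prod_eq_iff vec_eq_iff)
qed

lemma omega_N_rotate:
  assumes B: "orthonormal_basis B" and l: "\<And>j. cmod (l j) = 1"
  shows "omega_N B (rotate_N l u) (rotate_N l v) = omega_N B u v"
proof -
  have c: "(l j * a) \<bullet> (l j * b) = a \<bullet> b" for j a b
  proof -
    have "(l j * a) \<bullet> (l j * b) = ((Re (l j))\<^sup>2 + (Im (l j))\<^sup>2) * (a \<bullet> b)"
      by (simp add: inner_complex_def algebra_simps power2_eq_square)
    then show ?thesis using l[of j] by (simp flip: cmod_power2)
  qed
  have "rotate_z l a \<bullet> rotate_z l b = a \<bullet> b" for a b
    by (simp add: rotate_z_def inner_prod_def inner_vec_def c)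
  moreover have "mult_i (rotate_z l b) = rotate_z l (mult_i b)" for b
    by (simp add: mult_i_def rotate_z_def vec_eq_iff)
  ultimately show ?thesis by (simp add: omega_N_split[OF B] rotate_N_def)
qed

text \<open>The quadratic form of \<open>z_form j\<close> is \<open>|z\<^sub>1\<^sup>j|\<^sup>2 + |z\<^sub>2\<^sup>j|\<^sup>2\<close>, twice the momentum map of the \<open>j\<close>-th
  circle and four times the radius of the \<open>j\<close>-th sphere.\<close>

definition z_form :: "'n \<Rightarrow> (complex ^ 'n::finite) \<times> (complex ^ 'n) \<Rightarrow> (complex ^ 'n) \<times> (complex ^ 'n) \<Rightarrow> real" where
  "z_form j a b = fst a $ j \<bullet> fst b $ j + snd a $ j \<bullet> snd b $ j"

lemma bilinear_z_form: "bilinear (z_form j)"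
  unfolding bilinear_def
  by (intro conjI allI linearI) (simp_all add: z_form_def inner_add_left inner_add_right algebra_simps)

lemma norm_fst_psi: "norm (fst (psi x) $ j) = z_form j (fst x) (fst x) / 4"
  by (simp add: psi_eq norm_J z_form_def dot_square_norm)

lemma mem_tangent_M: "u \<in> tangent_M x \<longleftrightarrow> (\<forall>j. fst x $ j \<bullet> fst u $ j = 0)"
  by (auto simp: tangent_M_def split: prod.splits)

lemma mem_M: "x \<in> M \<longleftrightarrow> (\<forall>j. norm (fst x $ j) = 1)"
  by (auto simp: M_def split: prod.splits)

lemma Dpsi_inner: "fst (psi x) $ j \<bullet> fst (Dpsi x u) $ j
    = norm (fst (psi x) $ j) / 2 * z_form j (fst x) (fst u)"
  by (simp add: psi_eq Dpsi_def J_inner_DJ z_form_def)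

lemma Dpsi_surj:
  assumes "psi x \<in> P_star"
  shows "\<exists>v. Dpsi x v = u"
proof -
  have "\<exists>u1 u2. DJ (fst (fst x) $ j) (snd (fst x) $ j) u1 u2 = fst u $ j" for j
    using assms by (intro DJ_surj) (simp add: psi_eq P_star_def)
  then obtain u1 u2 where "\<And>j. DJ (fst (fst x) $ j) (snd (fst x) $ j) (u1 j) (u2 j) = fst u $ j" by metis
  then show ?thesis
    by (intro exI[of _ "(((\<chi> j. u1 j), (\<chi> j. u2 j)), snd u)"]) (simp add: Dpsi_def prod_eq_iff vec_eq_iff)
qed

text \<open>\<open>M\<close> is the reduced space of the torus action: a vector whose image is tangent to \<open>M\<close> is tangent
  to the level set of the momentum map, by \<open>Dpsi_inner\<close>, and there \<open>J_reduction\<close> applies on every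
  sphere.\<close>

lemma psi_reduction:
  assumes "psi x \<in> M" and "Dpsi x u \<in> tangent_M (psi x)" and "Dpsi x v \<in> tangent_M (psi x)"
  shows "omega_M B (psi x) (Dpsi x u) (Dpsi x v) = omega_N B u v"
proof -
  have n: "norm (fst (psi x) $ j) = 1" for j using assms(1) by (simp add: mem_M)
  have zu: "z_form j (fst x) (fst u) = 0" and zv: "z_form j (fst x) (fst v) = 0" for j
    using assms(2,3) n Dpsi_inner[of x j u] Dpsi_inner[of x j v] by (auto simp: mem_tangent_M)
  have "fst (psi x) $ j \<bullet> cross3 (fst (Dpsi x u) $ j) (fst (Dpsi x v) $ j)
     = (Im (fst (fst u) $ j) * Re (fst (fst v) $ j) - Re (fst (fst u) $ j) * Im (fst (fst v) $ j))
     + (Im (snd (fst u) $ j) * Re (snd (fst v) $ j) - Re (snd (fst u) $ j) * Im (snd (fst v) $ j))" for j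
    using J_reduction[OF zu[of j, unfolded z_form_def] zv[of j, unfolded z_form_def]] n[of j]
    by (simp add: psi_eq Dpsi_def)
  then have "(\<Sum>j\<in>UNIV. fst (psi x) $ j \<bullet> cross3 (fst (Dpsi x u) $ j) (fst (Dpsi x v) $ j))
     = (\<Sum>j\<in>UNIV. Im (fst (fst u) $ j) * Re (fst (fst v) $ j) - Re (fst (fst u) $ j) * Im (fst (fst v) $ j))
     + (\<Sum>j\<in>UNIV. Im (snd (fst u) $ j) * Re (snd (fst v) $ j) - Re (snd (fst u) $ j) * Im (snd (fst v) $ j))"
    by (simp add: sum.distrib)
  moreover have "snd (Dpsi x u) = snd u" "snd (Dpsi x v) = snd v" by (simp_all add: Dpsi_def)
  ultimately show ?thesis
    by (simp add: omega_M_def omega_N_def split_beta)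
qed

text \<open>Rotations are linear and affect only the \<open>z\<close> component, all of whose coordinates use the same
  coefficients; the stage equations are therefore equivariant if the vector field is.\<close>

lemma prk_stages_rotate:
  assumes D: "\<And>x. x \<in> D \<Longrightarrow> rotate_N l x \<in> D" and f: "\<And>x. x \<in> D \<Longrightarrow> f (rotate_N l x) = rotate_N l (f x)"
    and Y: "prk_stages s az ap aq h f D x Y"
  shows "prk_stages s az ap aq h f D (rotate_N l x) (\<lambda>i. rotate_N l (Y i))"
proof -
  have inD: "Y i \<in> D" if "i \<in> {1..s}" for i using Y that unfolding prk_stages_def by blast
  have fY: "f (rotate_N l (Y j)) = rotate_N l (f (Y j))" if "j \<in> {1..s}" for j
    using that by (intro f inD)
  note lin = linear_add[OF linear_rotate_z] linear_scale[OF linear_rotate_z] linear_sum[OF linear_rotate_z]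
  have "rotate_N l (Y i) = (fst (rotate_N l x) + h *\<^sub>R (\<Sum>j=1..s. az i j *\<^sub>R fst (f (rotate_N l (Y j)))),
       fst (snd (rotate_N l x)) + h *\<^sub>R (\<Sum>j=1..s. ap i j *\<^sub>R fst (snd (f (rotate_N l (Y j))))),
       snd (snd (rotate_N l x)) + h *\<^sub>R (\<Sum>j=1..s. aq i j *\<^sub>R snd (snd (f (rotate_N l (Y j))))))"
    if "i \<in> {1..s}" for i
  proof -
    have Yi: "Y i = (fst x + h *\<^sub>R (\<Sum>j=1..s. az i j *\<^sub>R fst (f (Y j))),
       fst (snd x) + h *\<^sub>R (\<Sum>j=1..s. ap i j *\<^sub>R fst (snd (f (Y j)))),
       snd (snd x) + h *\<^sub>R (\<Sum>j=1..s. aq i j *\<^sub>R snd (snd (f (Y j)))))"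
      using Y that unfolding prk_stages_def by blast
    show ?thesis
      by (subst Yi) (simp add: rotate_N_def lin fY[unfolded rotate_N_def] cong: sum.cong_simp)
  qed
  then show ?thesis using inD D unfolding prk_stages_def by blast
qed

lemma prk_update_rotate:
  assumes f: "\<And>i. i \<in> {1..s} \<Longrightarrow> f (rotate_N l (Y i)) = rotate_N l (f (Y i))"
  shows "prk_update s bz bp bq h f (rotate_N l x) (\<lambda>i. rotate_N l (Y i))
    = rotate_N l (prk_update s bz bp bq h f x Y)"
proof -
  note lin = linear_add[OF linear_rotate_z] linear_scale[OF linear_rotate_z] linear_sum[OF linear_rotate_z]
  show ?thesis
    by (simp add: prk_update_def rotate_N_def lin f[unfolded rotate_N_def] cong: sum.cong_simp)
qed

text \<open>The Hamiltonian \<open>H \<circ> psi\<close> is invariant under rotations, and rotations are symplectic.\<close>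

lemma hamiltonian_vector_field_rotate:
  assumes B: "orthonormal_basis B" and S: "open S" and X: "hamiltonian_vector_field_on B S (H \<circ> psi) X"
    and inv: "\<And>x. x \<in> S \<Longrightarrow> rotate_N l x \<in> S" and l: "\<And>j. cmod (l j) = 1"
    and d: "\<And>x. x \<in> S \<Longrightarrow> (H \<circ> psi) differentiable (at x)" and "x \<in> S"
  shows "X (rotate_N l x) = rotate_N l (X x)"
proof -
  let ?G = "H \<circ> psi" and ?R = "rotate_N l"
  let ?g = "frechet_derivative ?G (at (?R x))"
  have g: "(?G has_derivative ?g) (at (?R x))"
    using d[OF inv[OF \<open>x \<in> S\<close>]] by (simp add: frechet_derivative_works)
  have "bounded_linear ?R"
  proof -
    have bl: "bounded_linear (rotate_z l)"
      using linear_rotate_z by (simp add: linear_conv_bounded_linear)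
    show ?thesis
      unfolding rotate_N_def[abs_def]
      by (intro bounded_linear_Pair bounded_linear_compose[OF bl bounded_linear_fst] bounded_linear_snd)
  qed
  then have "(?R has_derivative ?R) (at x)" by (rule bounded_linear_imp_has_derivative)
  from has_derivative_compose[OF this g]
  have "(?G has_derivative (\<lambda>v. ?g (?R v))) (at x)"
    by (simp add: psi_rotate_N[OF l] o_def)
  then have "frechet_derivative ?G (at x) = (\<lambda>v. ?g (?R v))"
    using frechet_derivative_at by metis
  then show ?thesis
    using hamiltonian_dual_pushforward[OF B linear_rotate_N has_derivative_linear[OF g] omega_N_rotate[OF B l]]
    by (simp add: hamiltonian_vector_field_eq[OF B S X] \<open>x \<in> S\<close> inv)
qed

text \<open>Noether's theorem for the \<open>j\<close>-th circle: pairing the vector field with the infinitesimal rotation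
  \<open>t\<close> gives the derivative of \<open>H \<circ> psi\<close> along \<open>t\<close>, which is zero.\<close>

lemma hamiltonian_vector_field_tangent:
  fixes X :: "('n::finite, 'e::real_inner) N \<Rightarrow> ('n, 'e) N"
  assumes B: "orthonormal_basis B" and S: "open S" and X: "hamiltonian_vector_field_on B S (H \<circ> psi) X"
    and d: "H differentiable (at (psi x))" and "x \<in> S"
  shows "z_form j (fst x) (fst (X x)) = 0"
proof -
  let ?t = "((axis j (\<i> * fst (fst x) $ j), axis j (\<i> * snd (fst x) $ j)), 0, 0) :: ('n, 'e) N"
  have H: "(H has_derivative frechet_derivative H (at (psi x))) (at (psi x))"
    using d by (simp add: frechet_derivative_works)
  have G: "(H \<circ> psi has_derivative frechet_derivative H (at (psi x)) \<circ> Dpsi x) (at x)"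
    by (rule diff_chain_at[OF psi_has_derivative H])
  have "Dpsi x ?t = 0"
    by (auto simp: Dpsi_def prod_eq_iff vec_eq_iff[of _ "0 :: _ ^ 'n"] axis_def DJ_rotation DJ_zero)
  then have "frechet_derivative (H \<circ> psi) (at x) ?t = 0"
    using frechet_derivative_at[OF G] linear_0[OF has_derivative_linear[OF H]] by (metis comp_apply)
  then have "X x \<bullet> complex_structure ?t = 0"
    using omega_N_hamiltonian_dual[OF B, of "frechet_derivative (H \<circ> psi) (at x)" ?t]
      has_derivative_linear[OF G] frechet_derivative_at[OF G]
    by (simp add: hamiltonian_vector_field_eq[OF B S X \<open>x \<in> S\<close>] omega_N_eq_inner[OF B])
  moreover have "complex_structure ?t = ((axis j (- fst (fst x) $ j), axis j (- snd (fst x) $ j)), 0, 0)"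
    by (auto simp: complex_structure_def mult_i_def prod_eq_iff vec_eq_iff axis_def)
  ultimately have "fst (fst (X x)) $ j \<bullet> fst (fst x) $ j + snd (fst (X x)) $ j \<bullet> snd (fst x) $ j = 0"
    by (simp add: inner_prod_def inner_axis)
  then show ?thesis by (simp add: z_form_def inner_commute)
qed

section \<open>The induced map on the Poisson manifold\<close>

text \<open>The situation of the theorem with a choice \<open>Y\<close> of the stages.\<close>

locale collective_prk =
  fixes B :: "'e::real_inner set"
    and P\<^sub>0 :: "('n::finite, 'e) P set"
    and H :: "('n, 'e) P \<Rightarrow> real"
    and N\<^sub>0 U :: "('n, 'e) N set"
    and X \<Phi> :: "('n, 'e) N \<Rightarrow> ('n, 'e) N"
    and s :: nat
    and az ap aq :: "nat \<Rightarrow> nat \<Rightarrow> real"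
    and bz bp bq :: "nat \<Rightarrow> real"
    and h :: real
    and Y :: "('n, 'e) N \<Rightarrow> nat \<Rightarrow> ('n, 'e) N"
  assumes B: "orthonormal_basis B"
    and open_P\<^sub>0: "open P\<^sub>0" and P\<^sub>0_star: "P\<^sub>0 \<subseteq> P_star"
    and smooth_H: "smooth_on P\<^sub>0 H"
    and N\<^sub>0_def: "N\<^sub>0 = psi -` P\<^sub>0"
    and X: "hamiltonian_vector_field_on B N\<^sub>0 (H \<circ> psi) X"
    and open_U: "open U" and U_subset: "U \<subseteq> N\<^sub>0"
    and stages: "\<And>x. x \<in> U \<Longrightarrow> prk_stages s az ap aq h X N\<^sub>0 x (Y x)"
    and stages_unique: "\<And>x Y' i. x \<in> U \<Longrightarrow> prk_stages s az ap aq h X N\<^sub>0 x Y' \<Longrightarrow> i \<in> {1..s} \<Longrightarrow> Y' i = Y x i"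
    and smooth_Y: "\<And>i. i \<in> {1..s} \<Longrightarrow> smooth_on U (\<lambda>x. Y x i)"
    and update: "\<And>x. x \<in> U \<Longrightarrow> \<Phi> x = prk_update s bz bp bq h X x (Y x)"
    and rk: "symplectic_rk s az bz" and prk: "symplectic_prk s ap bp aq bq"
    and bb: "\<And>i. i \<in> {1..s} \<Longrightarrow> bz i = bp i \<and> bp i = bq i"
begin

lemma open_N\<^sub>0: "open N\<^sub>0"
  unfolding N\<^sub>0_def by (rule open_vimage[OF open_P\<^sub>0 continuous_on_psi])

lemma Y_mem: "x \<in> U \<Longrightarrow> i \<in> {1..s} \<Longrightarrow> Y x i \<in> N\<^sub>0"
  using stages unfolding prk_stages_def by blast

lemma H_differentiable: "y \<in> P\<^sub>0 \<Longrightarrow> H differentiable (at y)"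
  using smooth_H by (metis smooth_on_def Ck_on.simps(2))

lemma smooth_G: "smooth_on N\<^sub>0 (H \<circ> psi)"
proof -
  obtain E :: "('n, 'e) P set" where E: "parseval_frame E" using parseval_frame_P[OF B] by blast
  have "Ck_on k N\<^sub>0 (\<lambda>x. H (psi x))" for k
    using smooth_H
    by (intro Ck_on_compose[OF open_N\<^sub>0 open_P\<^sub>0 E _ Ck_on_psi[OF open_N\<^sub>0]]) (auto simp: N\<^sub>0_def smooth_on_def)
  then show ?thesis by (simp add: smooth_on_def o_def)
qed

lemma Ck_on_X: "Ck_on k N\<^sub>0 X"
  by (rule Ck_on_hamiltonian_vector_field[OF B open_N\<^sub>0 X smooth_G])

lemma Ck_on_Phi: "Ck_on k U \<Phi>"
proof -
  obtain E :: "('n, 'e) N set" where E: "parseval_frame E" using parseval_frame_N[OF B] by blast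
  have "Ck_on k U (\<lambda>x. prk_update s bz bp bq h X x (Y x))"
    using smooth_Y Y_mem
    by (intro Ck_on_prk_update[OF open_U open_N\<^sub>0 E _ _ Ck_on_X]) (auto simp: smooth_on_def)
  then show ?thesis
    by (rule Ck_on_cong[OF open_U, rotated]) (simp add: update)
qed

lemma Phi_has_derivative: "x \<in> U \<Longrightarrow> (\<Phi> has_derivative frechet_derivative \<Phi> (at x)) (at x)"
  by (rule Ck_on_Suc_derivative[OF Ck_on_Phi])

lemma Phi_symplectic:
  assumes "x \<in> U"
  shows "omega_N B (frechet_derivative \<Phi> (at x) u) (frechet_derivative \<Phi> (at x) v) = omega_N B u v"
proof -
  define Y' where "Y' i = frechet_derivative (\<lambda>x. Y x i) (at x)" for i
  define X' where "X' i = frechet_derivative X (at (Y x i))" for i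
  have Y': "((\<lambda>x. Y x i) has_derivative Y' i) (at x)" if "i \<in> {1..s}" for i
    unfolding Y'_def using smooth_Y[OF that] assms
    by (intro Ck_on_Suc_derivative[of 0 U]) (simp_all only: smooth_on_def)
  have X': "(X has_derivative X' i) (at (Y x i))" if "i \<in> {1..s}" for i
    unfolding X'_def by (rule Ck_on_Suc_derivative[OF Ck_on_X Y_mem[OF assms that]])
  have "(\<Phi> has_derivative (\<lambda>u. (fst u + h *\<^sub>R (\<Sum>i=1..s. bz i *\<^sub>R fst (X' i (Y' i u))),
               fst (snd u) + h *\<^sub>R (\<Sum>i=1..s. bp i *\<^sub>R fst (snd (X' i (Y' i u)))),
               snd (snd u) + h *\<^sub>R (\<Sum>i=1..s. bq i *\<^sub>R snd (snd (X' i (Y' i u))))))) (at x)"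
    by (rule prk_update_derivative[OF open_U assms update Y' X'])
  note \<Phi>' = frechet_derivative_at[OF this, symmetric]
  show ?thesis
    unfolding \<Phi>'
  proof (rule prk_update_symplectic[OF B rk prk bb])
    show "omega_N B (Y' i u) (X' i (Y' i v)) + omega_N B (X' i (Y' i u)) (Y' i v) = 0"
      if "i \<in> {1..s}" for i
      by (rule hamiltonian_linearization_skew[OF B open_N\<^sub>0 X smooth_G Y_mem[OF assms that] X'[OF that]])
  qed (assumption | rule prk_stages_derivative[OF open_U assms stages Y' X'])+
qed

lemma X_rotate:
  assumes l: "\<And>j. cmod (l j) = 1" and "x \<in> N\<^sub>0"
  shows "X (rotate_N l x) = rotate_N l (X x)"
proof (rule hamiltonian_vector_field_rotate[OF B open_N\<^sub>0 X _ l _ \<open>x \<in> N\<^sub>0\<close>])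
  show "(H \<circ> psi) differentiable (at x)" if "x \<in> N\<^sub>0" for x
    using that smooth_G by (metis smooth_on_def Ck_on.simps(2))
qed (simp add: N\<^sub>0_def psi_rotate_N[OF l])

text \<open>This is where uniqueness of the stages enters: rotating the stages of \<open>x\<close> gives stages for the
  rotated point, so \<open>\<Phi>\<close> commutes with the rotation from \<open>x\<close> to \<open>x'\<close>. Hence \<open>\<Phi>\<close> maps fibres of
  \<open>psi\<close> into fibres, although \<open>U\<close> itself may fail to be invariant.\<close>

lemma psi_Phi_cong:
  assumes "x \<in> U" and "x' \<in> U" and "psi x = psi x'"
  shows "psi (\<Phi> x) = psi (\<Phi> x')"
proof -
  obtain l where l: "\<And>j. cmod (l j) = 1" and x': "x' = rotate_N l x"
    using psi_fibre[OF assms(3)] by blast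
  have "prk_stages s az ap aq h X N\<^sub>0 x' (\<lambda>i. rotate_N l (Y x i))"
    unfolding x' using X_rotate[OF l] stages[OF assms(1)]
    by (intro prk_stages_rotate) (auto simp: N\<^sub>0_def psi_rotate_N[OF l])
  then have Y: "rotate_N l (Y x i) = Y x' i" if "i \<in> {1..s}" for i
    using stages_unique[OF assms(2) _ that] by blast
  have "\<Phi> x' = prk_update s bz bp bq h X (rotate_N l x) (\<lambda>i. rotate_N l (Y x i))"
    unfolding update[OF assms(2)] using Y by (simp add: prk_update_def x' cong: sum.cong_simp)
  also have "\<dots> = rotate_N l (\<Phi> x)"
    unfolding update[OF assms(1)] by (rule prk_update_rotate) (rule X_rotate[OF l Y_mem[OF assms(1)]])
  finally show ?thesis by (simp add: psi_rotate_N[OF l])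
qed

text \<open>The momentum map is a quadratic first integral of the vector field that depends on \<open>z\<close> only, so
  the symplectic Runge--Kutta method for \<open>z\<close> conserves it.\<close>

lemma norm_psi_Phi:
  assumes "x \<in> U"
  shows "norm (fst (psi (\<Phi> x)) $ j) = norm (fst (psi x) $ j)"
proof -
  have t: "z_form j (fst (Y x i)) (fst (X (Y x i))) = 0" if "i \<in> {1..s}" for i
    using Y_mem[OF assms that]
    by (intro hamiltonian_vector_field_tangent[OF B open_N\<^sub>0 X] H_differentiable) (auto simp: N\<^sub>0_def)
  have sym: "z_form j a b = z_form j b a" for a b by (simp add: z_form_def inner_commute)
  have cz: "bz i * bz k = bz i * az i k + bz k * az k i" if "i \<in> {1..s}" "k \<in> {1..s}" for i k
    using rk that by (simp only: symplectic_rk_def)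
  have "Y x i = (fst x + h *\<^sub>R (\<Sum>j=1..s. az i j *\<^sub>R fst (X (Y x j))),
       fst (snd x) + h *\<^sub>R (\<Sum>j=1..s. ap i j *\<^sub>R fst (snd (X (Y x j)))),
       snd (snd x) + h *\<^sub>R (\<Sum>j=1..s. aq i j *\<^sub>R snd (snd (X (Y x j)))))" if "i \<in> {1..s}" for i
    using stages[OF assms] that unfolding prk_stages_def by blast
  note Yz = arg_cong[where f = fst, OF this, unfolded fst_conv]
  have "z_form j (fst (\<Phi> x)) (fst (\<Phi> x)) = z_form j (fst x) (fst x) + h * (\<Sum>i=1..s.
      bz i * z_form j (fst (Y x i)) (fst (X (Y x i))) + bz i * z_form j (fst (X (Y x i))) (fst (Y x i)))"
    unfolding update[OF assms] prk_update_def fst_conv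
    by (rule rk_bilinear_increment[OF bilinear_z_form cz Yz Yz])
  then show ?thesis by (simp add: norm_fst_psi t sym[of "fst (X _)"])
qed

definition \<phi> :: "('n, 'e) P \<Rightarrow> ('n, 'e) P" where
  "\<phi> y = psi (\<Phi> (SOME x. x \<in> U \<and> psi x = y))"

lemma phi_psi: "x \<in> U \<Longrightarrow> \<phi> (psi x) = psi (\<Phi> x)"
  unfolding \<phi>_def by (rule someI2[of _ x]) (auto intro: psi_Phi_cong)

lemma psi_star: "x \<in> U \<Longrightarrow> psi x \<in> P_star"
  using U_subset P\<^sub>0_star by (auto simp: N\<^sub>0_def)

text \<open>A section through \<open>x\<close> stays in \<open>U\<close> near \<open>psi x\<close> because \<open>U\<close> is open. On its domain \<open>\<phi>\<close>
  equals \<open>psi \<circ> \<Phi> \<circ> \<sigma>\<close>, so that sections show both that \<open>psi ` U\<close> is open and that \<open>\<phi>\<close> is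
  smooth.\<close>

lemma local_section:
  assumes "x \<in> U"
  shows "\<exists>V \<sigma>. open V \<and> psi x \<in> V \<and> V \<subseteq> psi ` U \<and> (\<forall>k. Ck_on k V \<sigma>) \<and> \<sigma> ` V \<subseteq> U \<and> (\<forall>y\<in>V. psi (\<sigma> y) = y)"
proof -
  obtain W \<sigma> where W: "open W" "psi x \<in> W" and \<sigma>: "\<And>k. Ck_on k W \<sigma>"
    and sec: "\<And>y. y \<in> W \<Longrightarrow> psi (\<sigma> y) = y" and base: "\<sigma> (psi x) = x"
    using psi_local_section[OF psi_star[OF assms]] by blast
  have "continuous_on W \<sigma>" using \<sigma>[of 0] by simp
  then have "open (\<sigma> -` U \<inter> W)" using W(1) open_U by (simp add: continuous_on_open_vimage)
  moreover have "\<sigma> -` U \<inter> W \<subseteq> psi ` U" using sec by (metis IntE image_eqI subsetI vimageE)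
  ultimately show ?thesis
    using W(2) base assms sec Ck_on_subset[OF \<sigma>]
    by (intro exI[of _ "\<sigma> -` U \<inter> W"] exI[of _ \<sigma>]) auto
qed

lemma open_psi_U: "open (psi ` U)"
proof (subst open_subopen, intro ballI)
  fix y assume "y \<in> psi ` U"
  then obtain x where "x \<in> U" "y = psi x" by blast
  then show "\<exists>V. open V \<and> y \<in> V \<and> V \<subseteq> psi ` U" using local_section[of x] by blast
qed

lemma smooth_phi: "smooth_on (psi ` U) \<phi>"
  unfolding smooth_on_def
proof (intro allI Ck_on_locally)
  fix k y assume "y \<in> psi ` U"
  then obtain x where x: "x \<in> U" "y = psi x" by blast
  from local_section[OF x(1)] obtain V \<sigma> where V: "open V" "psi x \<in> V"
    and \<sigma>: "\<And>k. Ck_on k V \<sigma>" "\<sigma> ` V \<subseteq> U" "\<And>y. y \<in> V \<Longrightarrow> psi (\<sigma> y) = y"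
    by blast
  obtain E :: "('n, 'e) N set" where E: "parseval_frame E" using parseval_frame_N[OF B] by blast
  have "Ck_on k V (\<lambda>y. psi (\<Phi> (\<sigma> y)))"
    by (intro Ck_on_compose[OF V(1) open_UNIV E _ _ Ck_on_psi] Ck_on_compose[OF V(1) open_U E \<sigma>(2) \<sigma>(1) Ck_on_Phi]) auto
  then have "Ck_on k V \<phi>"
    using \<sigma>(2,3) phi_psi by (elim Ck_on_cong[OF V(1), rotated]) (metis image_subset_iff)
  then show "\<exists>V. open V \<and> y \<in> V \<and> Ck_on k V \<phi>" using V x(2) by blast
qed

lemma phi_has_derivative:
  assumes "x \<in> U"
  shows "(\<phi> has_derivative frechet_derivative \<phi> (at (psi x))) (at (psi x))"
  using smooth_phi assms by (intro Ck_on_Suc_derivative[of 0 "psi ` U"]) (auto simp only: smooth_on_def)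

lemma Dphi_Dpsi:
  assumes "x \<in> U"
  shows "frechet_derivative \<phi> (at (psi x)) (Dpsi x v) = Dpsi (\<Phi> x) (frechet_derivative \<Phi> (at x) v)"
proof -
  have "((\<lambda>x. psi (\<Phi> x)) has_derivative (\<lambda>v. Dpsi (\<Phi> x) (frechet_derivative \<Phi> (at x) v))) (at x)"
    by (rule has_derivative_compose[OF Phi_has_derivative[OF assms] psi_has_derivative])
  moreover have "((\<lambda>x. \<phi> (psi x)) has_derivative (\<lambda>v. frechet_derivative \<phi> (at (psi x)) (Dpsi x v))) (at x)"
    by (rule has_derivative_compose[OF psi_has_derivative phi_has_derivative[OF assms]])
  then have "((\<lambda>x. psi (\<Phi> x)) has_derivative (\<lambda>v. frechet_derivative \<phi> (at (psi x)) (Dpsi x v))) (at x)"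
    using open_U assms by (rule has_derivative_transform_within_open) (simp add: phi_psi)
  ultimately show ?thesis by (metis has_derivative_unique)
qed

text \<open>The bracket pairs the differential of one function with the dual of the other, and by
  \<open>hamiltonian_dual_pushforward\<close> duals are carried along by the derivative of a symplectic map.\<close>

lemma Phi_poisson:
  assumes "x \<in> U" and F: "F differentiable (at (\<Phi> x))" and G: "G differentiable (at (\<Phi> x))"
  shows "bracket_N B (F \<circ> \<Phi>) (G \<circ> \<Phi>) x = bracket_N B F G (\<Phi> x)"
proof -
  let ?A = "frechet_derivative \<Phi> (at x)"
  have d: "\<Phi> differentiable (at x)" using Phi_has_derivative[OF assms(1)] by (auto simp: differentiable_def)
  have "frechet_derivative (G \<circ> \<Phi>) (at x) = (\<lambda>v. frechet_derivative G (at (\<Phi> x)) (?A v))"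
    "frechet_derivative (F \<circ> \<Phi>) (at x) = (\<lambda>v. frechet_derivative F (at (\<Phi> x)) (?A v))"
    using frechet_derivative_compose[OF d] F G by (auto simp: o_def)
  moreover have "(F \<circ> \<Phi>) differentiable (at x)" using differentiable_chain_at[OF d F] .
  ultimately show ?thesis
    using hamiltonian_dual_pushforward[OF B linear_frechet_derivative[OF d] linear_frechet_derivative[OF G]
        Phi_symplectic[OF assms(1)]]
    by (simp add: bracket_N_eq F)
qed

text \<open>Both \<open>psi\<close> and \<open>\<Phi>\<close> are Poisson maps and \<open>psi\<close> maps \<open>U\<close> onto the domain of \<open>\<phi>\<close>, so the bracket can
  be computed upstairs, where \<open>\<phi> \<circ> psi\<close> agrees with \<open>psi \<circ> \<Phi>\<close>.\<close>

lemma phi_poisson: "poisson_map_on B (psi ` U) \<phi>"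
  unfolding poisson_map_on_def
proof (intro conjI open_psi_U smooth_phi allI impI ballI)
  fix V and f g :: "('n, 'e) P \<Rightarrow> real" and y
  assume V: "open V" and fg: "smooth_on V f" "smooth_on V g" and "y \<in> psi ` U" and "\<phi> y \<in> V"
  then obtain x where x: "x \<in> U" "y = psi x" by blast
  have inV: "psi (\<Phi> x) \<in> V" using \<open>\<phi> y \<in> V\<close> x by (simp add: phi_psi)
  have d: "k differentiable (at (psi (\<Phi> x)))" if "smooth_on V k" for k :: "('n, 'e) P \<Rightarrow> real"
    using that inV by (metis smooth_on_def Ck_on.simps(2))
  have psi_d: "psi differentiable (at z)" for z :: "('n, 'e) N"
    unfolding differentiable_def using psi_has_derivative by blast
  have d\<phi>: "(k \<circ> \<phi>) differentiable (at (psi x))" if "smooth_on V k" for k :: "('n, 'e) P \<Rightarrow> real"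
    using phi_has_derivative[OF x(1)] d[OF that]
    by (intro differentiable_chain_at) (auto simp: differentiable_def phi_psi x(1))
  have cong: "frechet_derivative (k \<circ> \<phi> \<circ> psi) (at x) = frechet_derivative (k \<circ> psi \<circ> \<Phi>) (at x)"
    if "smooth_on V k" for k :: "('n, 'e) P \<Rightarrow> real"
    using differentiable_chain_at[OF psi_d d\<phi>[OF that]] open_U x(1)
    by (rule frechet_derivative_transform_within_open) (simp add: phi_psi)
  have "bracket_P B (f \<circ> \<phi>) (g \<circ> \<phi>) (psi x) = bracket_N B (f \<circ> \<phi> \<circ> psi) (g \<circ> \<phi> \<circ> psi) x"
    using psi_poisson[OF d\<phi> d\<phi>] fg by metis
  also have "\<dots> = bracket_N B (f \<circ> psi \<circ> \<Phi>) (g \<circ> psi \<circ> \<Phi>) x"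
    unfolding bracket_N_def using cong fg by simp
  also have "\<dots> = bracket_N B (f \<circ> psi) (g \<circ> psi) (\<Phi> x)"
    using d fg by (intro Phi_poisson x(1) differentiable_chain_at psi_d) auto
  also have "\<dots> = bracket_P B f g (\<phi> y)"
    using psi_poisson[OF d d] fg by (simp add: x phi_psi)
  finally show "bracket_P B (f \<circ> \<phi>) (g \<circ> \<phi>) y = bracket_P B f g (\<phi> y)" by (simp add: x)
qed

lemma phi_leaf:
  assumes "L \<in> symplectic_leaves"
  shows "\<phi> ` (L \<inter> psi ` U) \<subseteq> L"
proof -
  from assms obtain r where "L = {(w, p, q). \<forall>j. norm (w $ j) = r j}"
    unfolding symplectic_leaves_def by blast
  then have L: "y \<in> L \<longleftrightarrow> (\<forall>j. norm (fst y $ j) = r j)" for y by (auto split: prod.splits)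
  show ?thesis by (auto simp: L phi_psi norm_psi_Phi)
qed

text \<open>Differentiating the conservation of \<open>(norm w\<^sub>j)\<^sup>2\<close>. Consequently the derivative of \<open>\<phi>\<close> respects
  tangency to \<open>M\<close>.\<close>

lemma phi_preserves_radial_derivative:
  assumes "x \<in> U"
  shows "fst (psi (\<Phi> x)) $ j \<bullet> fst (Dpsi (\<Phi> x) (frechet_derivative \<Phi> (at x) u)) $ j
    = fst (psi x) $ j \<bullet> fst (Dpsi x u) $ j"
proof -
  have nth: "((\<lambda>x. fst (k x) $ j) has_derivative (\<lambda>v. fst (k' v) $ j)) (at x)"
    if "(k has_derivative k') (at x)" for k k' :: "('n, 'e) N \<Rightarrow> ('n, 'e) P"
    by (intro bounded_linear.has_derivative[OF bounded_linear_vec_nth] has_derivative_fst that)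
  have d1: "((\<lambda>x. fst (psi x) $ j \<bullet> fst (psi x) $ j) has_derivative
      (\<lambda>u. fst (psi x) $ j \<bullet> fst (Dpsi x u) $ j + fst (Dpsi x u) $ j \<bullet> fst (psi x) $ j)) (at x)"
    by (intro has_derivative_inner nth psi_has_derivative)
  have "((\<lambda>x. fst (psi (\<Phi> x)) $ j \<bullet> fst (psi (\<Phi> x)) $ j) has_derivative
      (\<lambda>u. fst (psi (\<Phi> x)) $ j \<bullet> fst (Dpsi (\<Phi> x) (frechet_derivative \<Phi> (at x) u)) $ j
         + fst (Dpsi (\<Phi> x) (frechet_derivative \<Phi> (at x) u)) $ j \<bullet> fst (psi (\<Phi> x)) $ j)) (at x)"
    by (intro has_derivative_inner nth has_derivative_compose[OF Phi_has_derivative[OF assms] psi_has_derivative])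
  then have d2: "((\<lambda>x. fst (psi x) $ j \<bullet> fst (psi x) $ j) has_derivative
      (\<lambda>u. fst (psi (\<Phi> x)) $ j \<bullet> fst (Dpsi (\<Phi> x) (frechet_derivative \<Phi> (at x) u)) $ j
         + fst (Dpsi (\<Phi> x) (frechet_derivative \<Phi> (at x) u)) $ j \<bullet> fst (psi (\<Phi> x)) $ j)) (at x)"
    using open_U assms by (rule has_derivative_transform_within_open) (simp add: norm_psi_Phi dot_square_norm)
  show ?thesis
    using fun_cong[OF has_derivative_unique[OF d1 d2], of u] by (simp add: inner_commute)
qed

text \<open>Tangent vectors of \<open>M\<close> are lifted through the surjective derivative of \<open>psi\<close>. By \<open>psi_reduction\<close>,
  at \<open>x\<close> as well as at \<open>\<Phi> x\<close>, the form on \<open>M\<close> is the form \<open>omega_N\<close> of the lifts, which \<open>\<Phi>\<close>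
  preserves.\<close>

lemma phi_restricts: "restricts_to_symplectic_map_on_M B (psi ` U) \<phi>"
  unfolding restricts_to_symplectic_map_on_M_def
proof (intro conjI ballI)
  show "\<phi> ` (M \<inter> psi ` U) \<subseteq> M" by (auto simp: mem_M phi_psi norm_psi_Phi)
next
  fix y u v assume y: "y \<in> M \<inter> psi ` U" and u: "u \<in> tangent_M y" and v: "v \<in> tangent_M y"
  from y obtain x where x: "x \<in> U" "y = psi x" by blast
  let ?A = "frechet_derivative \<Phi> (at x)"
  have tan: "Dpsi (\<Phi> x) (?A w) \<in> tangent_M (psi (\<Phi> x))" if "Dpsi x w \<in> tangent_M y" for w
    using that by (simp add: mem_tangent_M x(2) phi_preserves_radial_derivative[OF x(1)])
  obtain u' where u': "Dpsi x u' = u" using Dpsi_surj[OF psi_star[OF x(1)]] by blast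
  obtain v' where v': "Dpsi x v' = v" using Dpsi_surj[OF psi_star[OF x(1)]] by blast
  note u' = u'[symmetric] and v' = v'[symmetric]
  show "frechet_derivative \<phi> (at y) u \<in> tangent_M (\<phi> y)"
    using tan u by (simp add: x u' Dphi_Dpsi phi_psi)
  have "psi (\<Phi> x) \<in> M" using y x by (simp add: mem_M norm_psi_Phi)
  then have "omega_M B (psi (\<Phi> x)) (Dpsi (\<Phi> x) (?A u')) (Dpsi (\<Phi> x) (?A v')) = omega_N B u' v'"
    using tan u v by (simp add: psi_reduction u' v' Phi_symplectic[OF x(1)])
  also have "\<dots> = omega_M B y u v"
    using y u v by (simp add: psi_reduction x(2) u' v')
  finally show "omega_M B (\<phi> y) (frechet_derivative \<phi> (at y) u) (frechet_derivative \<phi> (at y) v) = omega_M B y u v"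
    by (simp add: x u' v' Dphi_Dpsi phi_psi)
qed

end

theorem theorem4p3:
  fixes B :: "'e::real_inner set"
    and P\<^sub>0 :: "('n::finite, 'e) P set"
    and H :: "('n, 'e) P \<Rightarrow> real"
    and N\<^sub>0 U :: "('n, 'e) N set"
    and X \<Phi> :: "('n, 'e) N \<Rightarrow> ('n, 'e) N"
    and s :: nat
    and az ap aq :: "nat \<Rightarrow> nat \<Rightarrow> real"
    and bz bp bq :: "nat \<Rightarrow> real"
    and h :: real
  assumes "orthonormal_basis B"
    and "open P\<^sub>0" and "P\<^sub>0 \<subseteq> P_star"
    and "smooth_on P\<^sub>0 H"
    and "N\<^sub>0 = psi -` P\<^sub>0"
    and "hamiltonian_vector_field_on B N\<^sub>0 (H \<circ> psi) X"
    and "prk_update_map_on s az bz ap bp aq bq h X N\<^sub>0 U \<Phi>"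
    and "symplectic_rk s az bz"
    and "symplectic_prk s ap bp aq bq"
    and "\<forall>i\<in>{1..s}. bz i = bp i \<and> bp i = bq i"
  shows "symplectic_map_on_N B U \<Phi> \<and>
    (\<exists>\<phi>. (\<forall>x\<in>U. \<phi> (psi x) = psi (\<Phi> x)) \<and>
         poisson_map_on B (psi ` U) \<phi> \<and>
         (\<forall>L\<in>symplectic_leaves. \<phi> ` (L \<inter> psi ` U) \<subseteq> L) \<and>
         restricts_to_symplectic_map_on_M B (psi ` U) \<phi>)"
proof -
  from assms(7) obtain Y where "open U" "U \<subseteq> N\<^sub>0"
    and Y: "\<forall>x\<in>U. prk_stages s az ap aq h X N\<^sub>0 x (Y x)"
      "\<forall>x\<in>U. \<forall>Y'. prk_stages s az ap aq h X N\<^sub>0 x Y' \<longrightarrow> (\<forall>i\<in>{1..s}. Y' i = Y x i)"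
      "\<forall>i\<in>{1..s}. smooth_on U (\<lambda>x. Y x i)" "\<forall>x\<in>U. \<Phi> x = prk_update s bz bp bq h X x (Y x)"
    unfolding prk_update_map_on_def by blast
  interpret collective_prk B P\<^sub>0 H N\<^sub>0 U X \<Phi> s az ap aq bz bp bq h Y
  proof qed (fact assms | use \<open>open U\<close> \<open>U \<subseteq> N\<^sub>0\<close> Y assms(10) in blast)+
  have "symplectic_map_on_N B U \<Phi>"
    by (simp add: symplectic_map_on_N_def open_U smooth_on_def Ck_on_Phi Phi_symplectic)
  then show ?thesis
    using phi_psi phi_poisson phi_leaf phi_restricts by blast
qed

end
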